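(* Let $\delta\ge3$ be odd. If a $\delta$-PHO Hamiltonian $K^{(\delta)}$ is separable within a rotation of Cartesian coordinates, say within $\sigma(\psi)$, then there exists a unique $(2\delta-2)$-PHO Hamiltonian $K^{(2\delta-2)}$ whose BGNF up to degree $2\delta-2$ coincides with that of $K^{(\delta)}$; moreover $K^{(2\delta-2)}$ is separable within the same rotation, i.e. $K^{(2\delta-2)}(\sigma(\psi)^{-1}\tilde q,\sigma(\psi)^{-1}\tilde p)=\tfrac12\sum_j(\tilde p_j^2+\tilde q_j^2)+\tilde w_0\tilde q_2^{2\delta-2}+\tilde w_{2\delta-2}\tilde q_1^{2\delta-2}$ for some real constants $\tilde w_0,\tilde w_{2\delta-2}$.
   Context: For $d\ge3$, a $d$-PHO is the Hamiltonian $K^{(d)}(q,p)=\tfrac12\sum_{j=1}^2(p_j^2+q_j^2)+V^{(d)}(q)$ on $\mathbb R^4$, with $V^{(d)}(q)=\sum_{h=0}^{d}v^{(d)}_h\binom{d}{h}q_1^hq_2^{d-h}$, real coefficients, $V^{(d)}\not\equiv0$. $\sigma(\psi)=\begin{pmatrix}\cos\psi&-\sin\psi\\ \sin\psi&\cos\psi\end{pmatrix}$. A $d$-PHO is separable within a rotation of Cartesian coordinates if there exist $\psi\in[0,2\pi)$ and reals $(\tilde v_0,\tilde v_d)\ne(0,0)$ with $V^{(d)}(\sigma(\psi)^{-1}\tilde q)=\tilde v_0\tilde q_2^{d}+\tilde v_d\tilde q_1^{d}$ for all $\tilde q$. For $x,y\in\mathbb R^2$ let $D_{x,y}=\sum_{j=1}^2\big(x_j\partial/\partial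 y_j-y_j\partial/\partial x_j\big)$ and let $D^{(k)}_{x,y}$ be its restriction to homogeneous polynomials of degree $k$ in $(x,y)$. Given $K$ and $\rho\ge3$, its BGNF up to degree $\rho$ is the polynomial $G(\xi,\eta)=\tfrac12\sum_j(\eta_j^2+\xi_j^2)+\sum_{k=3}^{\rho}G_k(\xi,\eta)$, each $G_k$ homogeneous of degree $k$ with $G_k\in\ker D^{(k)}_{\xi,\eta}$, for which there is $W(q,\eta)=\sum_j q_j\eta_j+\sum_{k=3}^{\rho}W_k(q,\eta)$, each $W_k$ homogeneous of degree $k$ with $W_k\in\operatorname{image}D^{(k)}_{q,\eta}$, such that the power series in $(q,\eta)$ of $K(q,\partial W/\partial q)-G(\partial W/\partial\eta,\eta)$ has no terms of degree $\le\rho$; $G$ is uniquely determined. *)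

theory Defs
  imports "HOL-Analysis.Analysis"
begin

text \<open>Points of R^4 are written ((x1,x2),(y1,y2)).  Polynomials in four real
variables are rendered as real functions that are finite linear combinations of
monomials.\<close>

type_synonym pt4 = "(real \<times> real) \<times> (real \<times> real)"

fun mon :: "nat \<times> nat \<times> nat \<times> nat \<Rightarrow> pt4 \<Rightarrow> real" where
  "mon (a,b,c,d) ((x1,x2),(y1,y2)) = x1^a * x2^b * y1^c * y2^d"

fun degm :: "nat \<times> nat \<times> nat \<times> nat \<Rightarrow> nat" where
  "degm (a,b,c,d) = a+b+c+d"

definition homog :: "nat \<Rightarrow> (pt4 \<Rightarrow> real) \<Rightarrow> bool" where
  "homog k f \<longleftrightarrow> (\<exists>S c. finite S \<and> (\<forall>\<alpha>\<in>S. degm \<alpha> = k) \<and>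
      f = (\<lambda>z. \<Sum>\<alpha>\<in>S. c \<alpha> * mon \<alpha> z))"

definition no_terms_le :: "nat \<Rightarrow> (pt4 \<Rightarrow> real) \<Rightarrow> bool" where
  "no_terms_le \<rho> f \<longleftrightarrow> (\<exists>S c. finite S \<and> (\<forall>\<alpha>\<in>S. degm \<alpha> > \<rho>) \<and>
      f = (\<lambda>z. \<Sum>\<alpha>\<in>S. c \<alpha> * mon \<alpha> z))"

definition pdx1 :: "(pt4 \<Rightarrow> real) \<Rightarrow> pt4 \<Rightarrow> real" where
  "pdx1 f = (\<lambda>((x1,x2),(y1,y2)). deriv (\<lambda>t. f ((t,x2),(y1,y2))) x1)"
definition pdx2 :: "(pt4 \<Rightarrow> real) \<Rightarrow> pt4 \<Rightarrow> real" where
  "pdx2 f = (\<lambda>((x1,x2),(y1,y2)). deriv (\<lambda>t. f ((x1,t),(y1,y2))) x2)"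
definition pdy1 :: "(pt4 \<Rightarrow> real) \<Rightarrow> pt4 \<Rightarrow> real" where
  "pdy1 f = (\<lambda>((x1,x2),(y1,y2)). deriv (\<lambda>t. f ((x1,x2),(t,y2))) y1)"
definition pdy2 :: "(pt4 \<Rightarrow> real) \<Rightarrow> pt4 \<Rightarrow> real" where
  "pdy2 f = (\<lambda>((x1,x2),(y1,y2)). deriv (\<lambda>t. f ((x1,x2),(y1,t))) y2)"

definition Dop :: "(pt4 \<Rightarrow> real) \<Rightarrow> pt4 \<Rightarrow> real" where
  "Dop f = (\<lambda>((x1,x2),(y1,y2)).
      x1 * pdy1 f ((x1,x2),(y1,y2)) - y1 * pdx1 f ((x1,x2),(y1,y2))
    + x2 * pdy2 f ((x1,x2),(y1,y2)) - y2 * pdx2 f ((x1,x2),(y1,y2)))"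

fun harm :: "pt4 \<Rightarrow> real" where
  "harm ((q1,q2),(p1,p2)) = (p1^2 + q1^2 + p2^2 + q2^2) / 2"

fun Vpot :: "nat \<Rightarrow> (nat \<Rightarrow> real) \<Rightarrow> real \<times> real \<Rightarrow> real" where
  "Vpot d v (q1,q2) = (\<Sum>h=0..d. v h * real (d choose h) * q1^h * q2^(d-h))"

definition Kham :: "nat \<Rightarrow> (nat \<Rightarrow> real) \<Rightarrow> pt4 \<Rightarrow> real" where
  "Kham d v = (\<lambda>z. harm z + Vpot d v (fst z))"

definition is_PHO :: "nat \<Rightarrow> (pt4 \<Rightarrow> real) \<Rightarrow> bool" where
  "is_PHO d H \<longleftrightarrow> (\<exists>v. Vpot d v \<noteq> (\<lambda>_. 0) \<and> H = Kham d v)"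

fun rot :: "real \<Rightarrow> real \<times> real \<Rightarrow> real \<times> real" where
  "rot \<psi> (a,b) = (cos \<psi> * a - sin \<psi> * b, sin \<psi> * a + cos \<psi> * b)"

definition is_BGNF :: "nat \<Rightarrow> (pt4 \<Rightarrow> real) \<Rightarrow> (pt4 \<Rightarrow> real) \<Rightarrow> bool" where
  "is_BGNF \<rho> K G \<longleftrightarrow> (\<exists>Gk Wk :: nat \<Rightarrow> pt4 \<Rightarrow> real.
     (\<forall>k\<in>{3..\<rho>}. homog k (Gk k) \<and> Dop (Gk k) = (\<lambda>_. 0)) \<and>
     (\<forall>k\<in>{3..\<rho>}. \<exists>g. homog k g \<and> Wk k = Dop g) \<and>
     G = (\<lambda>z. harm z + (\<Sum>k=3..\<rho>. Gk k z)) \<and>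
     (let W = (\<lambda>z. fst (fst z) * fst (snd z) + snd (fst z) * snd (snd z)
                   + (\<Sum>k=3..\<rho>. Wk k z))
      in no_terms_le \<rho> (\<lambda>z. K (fst z, (pdx1 W z, pdx2 W z))
                            - G ((pdy1 W z, pdy2 W z), snd z))))"

end

theory Submission
  imports Defs
begin

text \<open>Write \<open>D\<close> for the operator \<open>Dop\<close>, let \<open>d = \<delta>\<close> be odd and \<open>\<rho> = 2 d - 2\<close>. Homogeneous
  polynomials of each degree split as \<open>ker D \<oplus> im D\<close>, with \<open>ker D = 0\<close> in odd degree, so the
  generating function equation can be solved degree by degree. For a \<open>\<rho>\<close>-PHO the only term of the
  normal form is the kernel part of the potential. For the \<open>d\<close>-PHO the term of degree \<open>d\<close> vanishes,
  \<open>W\<^sub>d = D\<^sup>-\<^sup>1 V\<close>, and the only term is the kernel part of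
  \<open>(|\<partial>\<^sub>q W\<^sub>d|\<^sup>2 - |\<partial>\<^sub>\<eta> W\<^sub>d|\<^sup>2) / 2\<close>.

  If \<open>V = X\<^sup>d\<close> with \<open>X\<close> a coordinate along a unit vector, then \<open>W\<^sub>d\<close> depends only on \<open>X\<close> and its
  conjugate \<open>Y\<close>, and with \<open>a = \<partial>W\<^sub>d/\<partial>X\<close>, \<open>b = \<partial>W\<^sub>d/\<partial>Y\<close> one has
  \<open>D a = d X\<^bsup>d-1\<^esup> - b\<close>, \<open>D b = a\<close>, \<open>X b - Y a = X\<^sup>d\<close>, hence
  \<open>a\<^sup>2 - b\<^sup>2 = D (a b + X\<^bsup>d-1\<^esup> a) - (2 d - 1) X\<^bsup>2d-2\<^esup>\<close>.
  Summing over the two separated directions yields the separable potential of degree \<open>\<rho>\<close>, with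
  coefficients \<open>- (2 d - 1) / 2\<close> times the squares of the given ones. It is unique because a
  nonzero potential \<open>V(q)\<close> of even degree is never in \<open>im D\<close>.\<close>

section \<open>Polynomial functions with prescribed degrees\<close>

text \<open>A common generalisation of \<open>homog\<close> and \<open>no_terms_le\<close>: the set
  holds the degrees that may occur, so all degree bookkeeping becomes inclusions and sums of sets.
  It concerns functions, not formal polynomials, and the representation need not be unique.\<close>

definition poly_on :: "nat set \<Rightarrow> (pt4 \<Rightarrow> real) \<Rightarrow> bool" where
  "poly_on D f \<longleftrightarrow> (\<exists>S c. finite S \<and> (\<forall>\<alpha>\<in>S. degm \<alpha> \<in> D) \<and>
      f = (\<lambda>z. \<Sum>\<alpha>\<in>S. c \<alpha> * mon \<alpha> z))"

lemma homog_iff_poly_on: "homog k f \<longleftrightarrow> poly_on {k} f"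
  by (simp add: homog_def poly_on_def)

lemma no_terms_le_iff_poly_on: "no_terms_le \<rho> f \<longleftrightarrow> poly_on {\<rho><..} f"
  by (simp add: no_terms_le_def poly_on_def)

lemma poly_on_mono: "poly_on A f \<Longrightarrow> A \<subseteq> B \<Longrightarrow> poly_on B f"
  unfolding poly_on_def by blast

lemma poly_on_zero [simp]: "poly_on D (\<lambda>z. 0)"
  unfolding poly_on_def by (rule exI[of _ "{}"]) simp

lemma poly_on_mon: "degm \<alpha> \<in> D \<Longrightarrow> poly_on D (\<lambda>z. c * mon \<alpha> z)"
  unfolding poly_on_def by (rule exI[of _ "{\<alpha>}"], rule exI[of _ "\<lambda>_. c"]) simp

lemma poly_on_add:
  assumes "poly_on D f" "poly_on D g"
  shows "poly_on D (\<lambda>z. f z + g z)"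
proof -
  obtain S c where S: "finite S" "\<forall>\<alpha>\<in>S. degm \<alpha> \<in> D" "f = (\<lambda>z. \<Sum>\<alpha>\<in>S. c \<alpha> * mon \<alpha> z)"
    using assms(1) unfolding poly_on_def by blast
  obtain T e where T: "finite T" "\<forall>\<alpha>\<in>T. degm \<alpha> \<in> D" "g = (\<lambda>z. \<Sum>\<alpha>\<in>T. e \<alpha> * mon \<alpha> z)"
    using assms(2) unfolding poly_on_def by blast
  define c' where "c' \<alpha> = (if \<alpha> \<in> S then c \<alpha> else 0)" for \<alpha>
  define e' where "e' \<alpha> = (if \<alpha> \<in> T then e \<alpha> else 0)" for \<alpha>
  have f: "f z = (\<Sum>\<alpha>\<in>S \<union> T. c' \<alpha> * mon \<alpha> z)" for z
    unfolding S(3) c'_def using S(1) T(1) by (intro sum.mono_neutral_cong_left) auto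
  have g: "g z = (\<Sum>\<alpha>\<in>S \<union> T. e' \<alpha> * mon \<alpha> z)" for z
    unfolding T(3) e'_def using S(1) T(1) by (intro sum.mono_neutral_cong_left) auto
  have "(\<lambda>z. f z + g z) = (\<lambda>z. \<Sum>\<alpha>\<in>S \<union> T. (c' \<alpha> + e' \<alpha>) * mon \<alpha> z)"
    by (simp add: f g sum.distrib distrib_right)
  moreover have "finite (S \<union> T)" "\<forall>\<alpha>\<in>S \<union> T. degm \<alpha> \<in> D"
    using S T by auto
  ultimately show ?thesis
    unfolding poly_on_def by (intro exI conjI)
qed

lemma poly_on_induct [consumes 1, case_names zero mon add]:
  assumes "poly_on D f"
    and "P (\<lambda>z. 0)"
    and "\<And>c \<alpha>. degm \<alpha> \<in> D \<Longrightarrow> P (\<lambda>z. c * mon \<alpha> z)"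
    and add: "\<And>f g. poly_on D f \<Longrightarrow> poly_on D g \<Longrightarrow> P f \<Longrightarrow> P g \<Longrightarrow> P (\<lambda>z. f z + g z)"
  shows "P f"
proof -
  obtain S c where S: "finite S" "\<forall>\<alpha>\<in>S. degm \<alpha> \<in> D" "f = (\<lambda>z. \<Sum>\<alpha>\<in>S. c \<alpha> * mon \<alpha> z)"
    using assms(1) unfolding poly_on_def by blast
  have "poly_on D (\<lambda>z. \<Sum>\<alpha>\<in>S. c \<alpha> * mon \<alpha> z) \<and> P (\<lambda>z. \<Sum>\<alpha>\<in>S. c \<alpha> * mon \<alpha> z)"
    using S(1,2)
  proof (induction S rule: finite_induct)
    case empty
    then show ?case using assms(2) by simp
  next
    case (insert \<alpha> S)
    have a: "poly_on D (\<lambda>z. c \<alpha> * mon \<alpha> z)"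
      using insert by (intro poly_on_mon) auto
    have b: "poly_on D (\<lambda>z. \<Sum>\<alpha>\<in>S. c \<alpha> * mon \<alpha> z)" "P (\<lambda>z. \<Sum>\<alpha>\<in>S. c \<alpha> * mon \<alpha> z)"
      using insert by auto
    have "P (\<lambda>z. c \<alpha> * mon \<alpha> z + (\<Sum>\<alpha>\<in>S. c \<alpha> * mon \<alpha> z))"
      using insert a b by (intro add assms(3)) auto
    with poly_on_add[OF a b(1)] show ?case
      using insert.hyps by simp
  qed
  with S(3) show ?thesis by simp
qed

lemma poly_on_cmult:
  assumes "poly_on D f"
  shows "poly_on D (\<lambda>z. c * f z)"
  using assms
proof (induction rule: poly_on_induct)
  case (mon e \<alpha>)
  then show ?case using poly_on_mon[of \<alpha> D "c * e"] by (simp add: mult.assoc)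
next
  case (add f g)
  then show ?case using poly_on_add[of D "\<lambda>z. c * f z" "\<lambda>z. c * g z"]
    by (simp add: distrib_left)
qed simp

lemma poly_on_minus: "poly_on D f \<Longrightarrow> poly_on D (\<lambda>z. - f z)"
  using poly_on_cmult[of D f "-1"] by simp

lemma poly_on_diff: "poly_on D f \<Longrightarrow> poly_on D g \<Longrightarrow> poly_on D (\<lambda>z. f z - g z)"
  using poly_on_add[of D f "\<lambda>z. - g z"] poly_on_minus[of D g] by simp

lemma poly_on_divide: "poly_on D f \<Longrightarrow> poly_on D (\<lambda>z. f z / c)"
  using poly_on_cmult[of D f "inverse c"] by (simp add: field_simps)

lemma poly_on_sum:
  "(\<And>i. i \<in> I \<Longrightarrow> poly_on D (f i)) \<Longrightarrow> poly_on D (\<lambda>z. \<Sum>i\<in>I. f i z)"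
  by (induction I rule: infinite_finite_induct) (auto intro: poly_on_add)

lemma mon_eq: "mon (a,b,c,d) z = fst (fst z)^a * snd (fst z)^b * fst (snd z)^c * snd (snd z)^d"
  by (metis mon.simps prod.collapse)

lemma mon_mult: "mon (a,b,c,d) z * mon (a',b',c',d') z = mon (a+a',b+b',c+c',d+d') z"
  by (simp add: mon_eq power_add mult_ac)

text \<open>Distributing both factors into monomials adds degrees, so \<open>C\<close> only has to
  contain every sum of a degree from \<open>A\<close> and one from \<open>B\<close>.\<close>

lemma poly_on_mult:
  assumes "poly_on A f" "poly_on B g" and AB: "\<And>a b. a \<in> A \<Longrightarrow> b \<in> B \<Longrightarrow> a + b \<in> C"
  shows "poly_on C (\<lambda>z. f z * g z)"
  using assms(1)
proof (induction rule: poly_on_induct)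
  case (mon c \<alpha>)
  show ?case
    using assms(2)
  proof (induction rule: poly_on_induct)
    case (mon e \<beta>)
    obtain a b c1 d where \<alpha>: "\<alpha> = (a,b,c1,d)" by (cases \<alpha>)
    obtain a' b' c1' d' where \<beta>: "\<beta> = (a',b',c1',d')" by (cases \<beta>)
    have "degm (a+a',b+b',c1+c1',d+d') \<in> C"
      using AB[OF \<open>degm \<alpha> \<in> A\<close> mon] by (simp add: \<alpha> \<beta> algebra_simps)
    from poly_on_mon[OF this, of "c * e"] show ?case
      unfolding mon_mult[symmetric] by (simp add: \<alpha> \<beta> mult_ac)
  next
    case (add f g)
    then show ?case using poly_on_add[OF add.IH] by (simp add: distrib_left)
  qed simp
next
  case (add f g)
  then show ?case using poly_on_add[OF add.IH] by (simp add: distrib_right)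
qed simp

lemma poly_on_const: "poly_on {0} (\<lambda>z. c)"
  using poly_on_mon[of "(0,0,0,0)" "{0}" c] by (simp add: mon_eq)

lemma poly_on_coords:
  "poly_on {1} (\<lambda>z. fst (fst z))" "poly_on {1} (\<lambda>z. snd (fst z))"
  "poly_on {1} (\<lambda>z. fst (snd z))" "poly_on {1} (\<lambda>z. snd (snd z))"
  using poly_on_mon[of "(1,0,0,0)" "{1}" 1] poly_on_mon[of "(0,1,0,0)" "{1}" 1]
    poly_on_mon[of "(0,0,1,0)" "{1}" 1] poly_on_mon[of "(0,0,0,1)" "{1}" 1]
  by (simp_all add: mon_eq)

lemma poly_on_power:
  assumes "poly_on {k} f"
  shows "poly_on {n * k} (\<lambda>z. f z ^ n)"
proof (induction n)
  case 0
  then show ?case using poly_on_const[of 1] by simp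
next
  case (Suc n)
  then show ?case using poly_on_mult[OF assms Suc] by simp
qed

text \<open>Meant for properties compatible with sums and products, such as differentiability or
  identities between derivations, where checking constants and the four coordinates is enough.
  Degrees play no part there, hence \<open>UNIV\<close> in the cases.\<close>

lemma poly_on_ring_induct [consumes 1, case_names const x1 x2 y1 y2 add mult]:
  assumes "poly_on D f"
    and const: "\<And>c. P (\<lambda>z. c)"
    and x1: "P (\<lambda>z. fst (fst z))" and x2: "P (\<lambda>z. snd (fst z))"
    and y1: "P (\<lambda>z. fst (snd z))" and y2: "P (\<lambda>z. snd (snd z))"
    and add: "\<And>f g. poly_on UNIV f \<Longrightarrow> poly_on UNIV g \<Longrightarrow> P f \<Longrightarrow> P g \<Longrightarrow> P (\<lambda>z. f z + g z)"
    and mult: "\<And>f g. poly_on UNIV f \<Longrightarrow> poly_on UNIV g \<Longrightarrow> P f \<Longrightarrow> P g \<Longrightarrow> P (\<lambda>z. f z * g z)"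
  shows "P f"
proof -
  define Q where "Q f \<longleftrightarrow> poly_on UNIV f \<and> P f" for f
  have Qc: "Q (\<lambda>z. c)" for c
    unfolding Q_def using const poly_on_mono[OF poly_on_const] by auto
  have Qm: "Q (\<lambda>z. f z * g z)" if "Q f" "Q g" for f g
    using that mult poly_on_mult[of UNIV f UNIV g UNIV] unfolding Q_def by auto
  have Qp: "Q (\<lambda>z. f z ^ n)" if "Q f" for f n
    by (induction n) (auto intro: Qm Qc that)
  have Qx: "Q (\<lambda>z. fst (fst z))" "Q (\<lambda>z. snd (fst z))" "Q (\<lambda>z. fst (snd z))" "Q (\<lambda>z. snd (snd z))"
    unfolding Q_def using x1 x2 y1 y2 poly_on_mono[OF poly_on_coords(1)]
      poly_on_mono[OF poly_on_coords(2)] poly_on_mono[OF poly_on_coords(3)]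
      poly_on_mono[OF poly_on_coords(4)] by auto
  have "Q f" using assms(1)
  proof (induction rule: poly_on_induct)
    case zero
    show ?case by (rule Qc)
  next
    case (mon c \<alpha>)
    show ?case
      by (cases \<alpha>) (auto simp: mon_eq intro!: Qm Qc Qp Qx)
  next
    case (add f g)
    then show ?case
      unfolding Q_def using assms(7)[of f g] poly_on_add[of UNIV f g] by simp
  qed
  then show ?thesis unfolding Q_def by simp
qed

section \<open>Scaling along rays and comparison of lowest degrees\<close>

lemma poly_on_scale:
  assumes "poly_on {k} f"
  shows "f (s *\<^sub>R z) = s ^ k * f z"
  using assms
proof (induction rule: poly_on_induct)
  case (mon c \<alpha>)
  then show ?case
    by (cases \<alpha>) (auto simp: mon_eq power_mult_distrib power_add mult_ac)
qed (auto simp: distrib_left)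

text \<open>On a fixed ray a monomial of degree above \<open>m\<close> scales by a power of
  \<open>s\<close> that is at most \<open>s ^ Suc m\<close>, since \<open>s\<close> lies between 0
  and 1; the constants of the finitely many monomials add up.\<close>

lemma poly_on_greaterThan_bound:
  assumes "poly_on {m<..} f"
  shows "\<exists>C. \<forall>s. 0 \<le> s \<and> s \<le> 1 \<longrightarrow> \<bar>f (s *\<^sub>R z)\<bar> \<le> C * s ^ Suc m"
  using assms
proof (induction rule: poly_on_induct)
  case zero
  show ?case by (rule exI[of _ 0]) simp
next
  case (mon c \<alpha>)
  have "\<bar>c * mon \<alpha> (s *\<^sub>R z)\<bar> \<le> \<bar>c * mon \<alpha> z\<bar> * s ^ Suc m" if s: "0 \<le> s" "s \<le> 1" for s
  proof -
    have "mon \<alpha> (s *\<^sub>R z) = s ^ degm \<alpha> * mon \<alpha> z"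
      using poly_on_scale[OF poly_on_mon[of \<alpha> "{degm \<alpha>}" 1]] by simp
    then have "\<bar>c * mon \<alpha> (s *\<^sub>R z)\<bar> = \<bar>c * mon \<alpha> z\<bar> * s ^ degm \<alpha>"
      using s by (simp add: abs_mult mult_ac)
    also have "\<dots> \<le> \<bar>c * mon \<alpha> z\<bar> * s ^ Suc m"
      using mon s by (intro mult_left_mono power_decreasing) auto
    finally show ?thesis .
  qed
  then show ?case by blast
next
  case (add f g)
  then obtain C C' where
    "\<And>s. 0 \<le> s \<Longrightarrow> s \<le> 1 \<Longrightarrow> \<bar>f (s *\<^sub>R z)\<bar> \<le> C * s ^ Suc m"
    "\<And>s. 0 \<le> s \<Longrightarrow> s \<le> 1 \<Longrightarrow> \<bar>g (s *\<^sub>R z)\<bar> \<le> C' * s ^ Suc m"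
    by blast
  then have "0 \<le> s \<Longrightarrow> s \<le> 1 \<Longrightarrow> \<bar>f (s *\<^sub>R z) + g (s *\<^sub>R z)\<bar> \<le> (C + C') * s ^ Suc m" for s
    unfolding distrib_right by (rule order_trans[OF abs_triangle_ineq add_mono])
  then show ?case by blast
qed

text \<open>On a ray \<open>f\<close> equals \<open>s ^ m * f z\<close> and is also bounded by a
  multiple of \<open>s ^ Suc m\<close>; dividing by \<open>s ^ m\<close> and letting
  \<open>s\<close> tend to 0 gives \<open>f z = 0\<close>. This replaces the comparison of
  coefficients of formal polynomials.\<close>

lemma homog_higher_order_zero:
  assumes "poly_on {m} f" "poly_on {m<..} f"
  shows "f = (\<lambda>z. 0)"
proof
  fix z
  obtain C where C: "\<And>s. 0 \<le> s \<Longrightarrow> s \<le> 1 \<Longrightarrow> \<bar>f (s *\<^sub>R z)\<bar> \<le> C * s ^ Suc m"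
    using poly_on_greaterThan_bound[OF assms(2)] by blast
  have *: "\<bar>f z\<bar> \<le> C * s" if "0 < s" "s \<le> 1" for s
  proof -
    have "s ^ m * \<bar>f z\<bar> \<le> s ^ m * (C * s)"
      using C[of s] that poly_on_scale[OF assms(1), of s z] by (simp add: abs_mult mult_ac)
    then show ?thesis using that by simp
  qed
  have "((\<lambda>s. C * s) \<longlongrightarrow> C * 0) (at_right 0)"
    by (intro tendsto_intros)
  moreover have "eventually (\<lambda>s. \<bar>f z\<bar> \<le> C * s) (at_right (0::real))"
    unfolding eventually_at_right_field using * by (intro exI[of _ 1]) auto
  ultimately have "\<bar>f z\<bar> \<le> C * 0"
    by (intro tendsto_lowerbound) auto
  then show "f z = 0" by simp
qed

section \<open>Derivatives of polynomial functions\<close>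

abbreviation dd :: "(pt4 \<Rightarrow> real) \<Rightarrow> pt4 \<Rightarrow> pt4 \<Rightarrow> real" where
  "dd f z \<equiv> frechet_derivative f (at z)"

lemma poly_on_has_derivative:
  assumes "poly_on D f"
  shows "(f has_derivative dd f z) (at z)"
proof -
  have "f differentiable at z"
    using assms
  proof (induction rule: poly_on_ring_induct)
    case x1
    then show ?case unfolding differentiable_def by (intro exI) (auto intro!: derivative_eq_intros)
  next
    case x2
    then show ?case unfolding differentiable_def by (intro exI) (auto intro!: derivative_eq_intros)
  next
    case y1
    then show ?case unfolding differentiable_def by (intro exI) (auto intro!: derivative_eq_intros)
  next
    case y2
    then show ?case unfolding differentiable_def by (intro exI) (auto intro!: derivative_eq_intros)
  qed auto
  then show ?thesis by (simp add: frechet_derivative_works)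
qed

lemma dd_eqI: "(f has_derivative f') (at z) \<Longrightarrow> dd f z e = f' e"
  using frechet_derivative_at by metis

lemma dd_const: "dd (\<lambda>z. c) z e = 0"
  by (rule dd_eqI) simp

lemma dd_coords:
  "dd (\<lambda>z. fst (fst z)) z e = fst (fst e)" "dd (\<lambda>z. snd (fst z)) z e = snd (fst e)"
  "dd (\<lambda>z. fst (snd z)) z e = fst (snd e)" "dd (\<lambda>z. snd (snd z)) z e = snd (snd e)"
  by (rule dd_eqI, auto intro!: derivative_eq_intros)+

lemma dd_add:
  "poly_on D f \<Longrightarrow> poly_on E g \<Longrightarrow> dd (\<lambda>z. f z + g z) z e = dd f z e + dd g z e"
  by (rule dd_eqI) (intro has_derivative_add poly_on_has_derivative)

lemma dd_mult:
  "poly_on D f \<Longrightarrow> poly_on E g \<Longrightarrow> dd (\<lambda>z. f z * g z) z e = f z * dd g z e + dd f z e * g z"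
  by (rule dd_eqI) (intro has_derivative_mult poly_on_has_derivative)

lemma dd_linear:
  assumes "poly_on D f"
  shows "linear (dd f z)"
  using has_derivative_linear[OF poly_on_has_derivative[OF assms]] .

text \<open>A coordinate line is a curve of constant velocity, so the chain rule turns the
  one-variable \<open>deriv\<close> into the Frechet derivative at a basis vector. All rules for
  partial derivatives are obtained from those for \<open>dd\<close> in this way.\<close>

lemma pd_eq_dd:
  assumes "poly_on D f"
  shows "pdx1 f z = dd f z ((1,0),(0,0))" "pdx2 f z = dd f z ((0,1),(0,0))"
    "pdy1 f z = dd f z ((0,0),(1,0))" "pdy2 f z = dd f z ((0,0),(0,1))"
proof -
  have D: "(f has_derivative dd f z) (at z)" for z
    by (rule poly_on_has_derivative[OF assms])
  have L: "dd f z (s *\<^sub>R e) = s * dd f z e" for s e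
    using linear_cmul[OF dd_linear[OF assms]] by simp
  have *: "deriv (\<lambda>t. f (c t)) t0 = dd f z e"
    if "\<And>t. (c has_derivative (\<lambda>s. s *\<^sub>R e)) (at t)" "c t0 = z" for c t0 e
  proof (rule DERIV_imp_deriv)
    have "((\<lambda>t. f (c t)) has_derivative (\<lambda>s. dd f (c t0) (s *\<^sub>R e))) (at t0)"
      using has_derivative_compose[OF that(1) D] .
    then show "((\<lambda>t. f (c t)) has_field_derivative dd f z e) (at t0)"
      unfolding has_field_derivative_def that(2) L
      by (rule has_derivative_eq_rhs) (simp add: fun_eq_iff)
  qed
  show "pdx1 f z = dd f z ((1,0),(0,0))" "pdx2 f z = dd f z ((0,1),(0,0))"
    "pdy1 f z = dd f z ((0,0),(1,0))" "pdy2 f z = dd f z ((0,0),(0,1))"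
    unfolding pdx1_def pdx2_def pdy1_def pdy2_def case_prod_unfold
    by (rule *; auto intro!: derivative_eq_intros simp: fun_eq_iff zero_prod_def)+
qed

lemma dd_eq_pd:
  assumes "poly_on D f"
  shows "dd f z ((a,b),(c,d)) = a * pdx1 f z + b * pdx2 f z + c * pdy1 f z + d * pdy2 f z"
proof -
  interpret linear "dd f z" by (rule dd_linear[OF assms])
  have "((a,b),(c,d)) = a *\<^sub>R ((1,0),(0,0)) + b *\<^sub>R ((0,1),(0,0))
      + c *\<^sub>R ((0,0),(1,0)) + d *\<^sub>R ((0,0),(0,1::real))"
    by simp
  then have "dd f z ((a,b),(c,d)) = dd f z (a *\<^sub>R ((1,0),(0,0)) + b *\<^sub>R ((0,1),(0,0))
      + c *\<^sub>R ((0,0),(1,0)) + d *\<^sub>R ((0,0),(0,1)))"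
    by (rule arg_cong)
  then show ?thesis
    by (simp only: add scale pd_eq_dd[OF assms]) simp
qed

text \<open>The linear vector field along which \<open>Dop\<close> differentiates; it turns each
  plane (x_j, y_j) by a right angle.\<close>

definition rotgen :: "pt4 \<Rightarrow> pt4" where
  "rotgen z = (- snd z, fst z)"

lemma Dop_eq_pd:
  "Dop f z = fst (fst z) * pdy1 f z - fst (snd z) * pdx1 f z
    + snd (fst z) * pdy2 f z - snd (snd z) * pdx2 f z"
  unfolding Dop_def by (simp add: case_prod_unfold)

lemma Dop_eq_dd:
  assumes "poly_on D f"
  shows "Dop f z = dd f z (rotgen z)"
proof -
  have "rotgen z = ((- fst (snd z), - snd (snd z)), (fst (fst z), snd (fst z)))"
    by (simp add: rotgen_def prod_eq_iff)
  then show ?thesis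
    unfolding Dop_eq_pd by (simp only: dd_eq_pd[OF assms])
qed

lemma pd_add:
  assumes "poly_on D f" "poly_on E g"
  shows "pdx1 (\<lambda>z. f z + g z) = (\<lambda>z. pdx1 f z + pdx1 g z)"
    "pdx2 (\<lambda>z. f z + g z) = (\<lambda>z. pdx2 f z + pdx2 g z)"
    "pdy1 (\<lambda>z. f z + g z) = (\<lambda>z. pdy1 f z + pdy1 g z)"
    "pdy2 (\<lambda>z. f z + g z) = (\<lambda>z. pdy2 f z + pdy2 g z)"
    "Dop (\<lambda>z. f z + g z) = (\<lambda>z. Dop f z + Dop g z)"
proof -
  have U: "poly_on UNIV f" "poly_on UNIV g" using assms poly_on_mono by blast+
  then have V: "poly_on UNIV (\<lambda>z. f z + g z)" by (rule poly_on_add)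
  show "pdx1 (\<lambda>z. f z + g z) = (\<lambda>z. pdx1 f z + pdx1 g z)"
    "pdx2 (\<lambda>z. f z + g z) = (\<lambda>z. pdx2 f z + pdx2 g z)"
    "pdy1 (\<lambda>z. f z + g z) = (\<lambda>z. pdy1 f z + pdy1 g z)"
    "pdy2 (\<lambda>z. f z + g z) = (\<lambda>z. pdy2 f z + pdy2 g z)"
    "Dop (\<lambda>z. f z + g z) = (\<lambda>z. Dop f z + Dop g z)"
    by (simp_all add: fun_eq_iff pd_eq_dd[OF V] pd_eq_dd[OF U(1)] pd_eq_dd[OF U(2)]
        Dop_eq_dd[OF V] Dop_eq_dd[OF U(1)] Dop_eq_dd[OF U(2)] dd_add[OF assms])
qed

lemma pd_mult:
  assumes "poly_on D f" "poly_on E g"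
  shows "pdx1 (\<lambda>z. f z * g z) = (\<lambda>z. f z * pdx1 g z + pdx1 f z * g z)"
    "pdx2 (\<lambda>z. f z * g z) = (\<lambda>z. f z * pdx2 g z + pdx2 f z * g z)"
    "pdy1 (\<lambda>z. f z * g z) = (\<lambda>z. f z * pdy1 g z + pdy1 f z * g z)"
    "pdy2 (\<lambda>z. f z * g z) = (\<lambda>z. f z * pdy2 g z + pdy2 f z * g z)"
    "Dop (\<lambda>z. f z * g z) = (\<lambda>z. f z * Dop g z + Dop f z * g z)"
proof -
  have U: "poly_on UNIV f" "poly_on UNIV g" using assms poly_on_mono by blast+
  then have V: "poly_on UNIV (\<lambda>z. f z * g z)" by (rule poly_on_mult) auto
  show "pdx1 (\<lambda>z. f z * g z) = (\<lambda>z. f z * pdx1 g z + pdx1 f z * g z)"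
    "pdx2 (\<lambda>z. f z * g z) = (\<lambda>z. f z * pdx2 g z + pdx2 f z * g z)"
    "pdy1 (\<lambda>z. f z * g z) = (\<lambda>z. f z * pdy1 g z + pdy1 f z * g z)"
    "pdy2 (\<lambda>z. f z * g z) = (\<lambda>z. f z * pdy2 g z + pdy2 f z * g z)"
    "Dop (\<lambda>z. f z * g z) = (\<lambda>z. f z * Dop g z + Dop f z * g z)"
    by (simp_all add: fun_eq_iff pd_eq_dd[OF V] pd_eq_dd[OF U(1)] pd_eq_dd[OF U(2)]
        Dop_eq_dd[OF V] Dop_eq_dd[OF U(1)] Dop_eq_dd[OF U(2)] dd_mult[OF assms])
qed

lemma pd_const:
  "pdx1 (\<lambda>z. c) = (\<lambda>z. 0)" "pdx2 (\<lambda>z. c) = (\<lambda>z. 0)"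
  "pdy1 (\<lambda>z. c) = (\<lambda>z. 0)" "pdy2 (\<lambda>z. c) = (\<lambda>z. 0)" "Dop (\<lambda>z. c) = (\<lambda>z. 0)"
  by (simp_all add: fun_eq_iff pd_eq_dd[OF poly_on_const] Dop_eq_dd[OF poly_on_const] dd_const)

lemma pd_cmult:
  assumes "poly_on D f"
  shows "pdx1 (\<lambda>z. c * f z) = (\<lambda>z. c * pdx1 f z)" "pdx2 (\<lambda>z. c * f z) = (\<lambda>z. c * pdx2 f z)"
    "pdy1 (\<lambda>z. c * f z) = (\<lambda>z. c * pdy1 f z)" "pdy2 (\<lambda>z. c * f z) = (\<lambda>z. c * pdy2 f z)"
    "Dop (\<lambda>z. c * f z) = (\<lambda>z. c * Dop f z)"
  using pd_mult[OF poly_on_const assms, of c] by (simp_all add: pd_const)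

lemma Dop_minus: "poly_on D f \<Longrightarrow> Dop (\<lambda>z. - f z) = (\<lambda>z. - Dop f z)"
  using pd_cmult(5)[of D f "-1"] by simp

lemma Dop_diff:
  assumes "poly_on D f" "poly_on E g"
  shows "Dop (\<lambda>z. f z - g z) = (\<lambda>z. Dop f z - Dop g z)"
  using pd_add(5)[OF assms(1) poly_on_minus[OF assms(2)]] Dop_minus[OF assms(2)] by simp

lemma pd_coords:
  "pdx1 (\<lambda>z. fst (fst z)) = (\<lambda>z. 1)" "pdx2 (\<lambda>z. fst (fst z)) = (\<lambda>z. 0)"
  "pdy1 (\<lambda>z. fst (fst z)) = (\<lambda>z. 0)" "pdy2 (\<lambda>z. fst (fst z)) = (\<lambda>z. 0)"
  "pdx1 (\<lambda>z. snd (fst z)) = (\<lambda>z. 0)" "pdx2 (\<lambda>z. snd (fst z)) = (\<lambda>z. 1)"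
  "pdy1 (\<lambda>z. snd (fst z)) = (\<lambda>z. 0)" "pdy2 (\<lambda>z. snd (fst z)) = (\<lambda>z. 0)"
  "pdx1 (\<lambda>z. fst (snd z)) = (\<lambda>z. 0)" "pdx2 (\<lambda>z. fst (snd z)) = (\<lambda>z. 0)"
  "pdy1 (\<lambda>z. fst (snd z)) = (\<lambda>z. 1)" "pdy2 (\<lambda>z. fst (snd z)) = (\<lambda>z. 0)"
  "pdx1 (\<lambda>z. snd (snd z)) = (\<lambda>z. 0)" "pdx2 (\<lambda>z. snd (snd z)) = (\<lambda>z. 0)"
  "pdy1 (\<lambda>z. snd (snd z)) = (\<lambda>z. 0)" "pdy2 (\<lambda>z. snd (snd z)) = (\<lambda>z. 1)"
  by (simp_all add: fun_eq_iff pd_eq_dd[OF poly_on_coords(1)] pd_eq_dd[OF poly_on_coords(2)]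
      pd_eq_dd[OF poly_on_coords(3)] pd_eq_dd[OF poly_on_coords(4)] dd_coords)

lemma Dop_coords:
  "Dop (\<lambda>z. fst (fst z)) = (\<lambda>z. - fst (snd z))" "Dop (\<lambda>z. snd (fst z)) = (\<lambda>z. - snd (snd z))"
  "Dop (\<lambda>z. fst (snd z)) = (\<lambda>z. fst (fst z))" "Dop (\<lambda>z. snd (snd z)) = (\<lambda>z. snd (fst z))"
  by (simp_all add: fun_eq_iff Dop_eq_pd pd_coords)

lemma pd_power:
  assumes "poly_on {k} f"
  shows "pdx1 (\<lambda>z. f z ^ n) = (\<lambda>z. real n * f z ^ (n - 1) * pdx1 f z)"
    "pdx2 (\<lambda>z. f z ^ n) = (\<lambda>z. real n * f z ^ (n - 1) * pdx2 f z)"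
    "pdy1 (\<lambda>z. f z ^ n) = (\<lambda>z. real n * f z ^ (n - 1) * pdy1 f z)"
    "pdy2 (\<lambda>z. f z ^ n) = (\<lambda>z. real n * f z ^ (n - 1) * pdy2 f z)"
    "Dop (\<lambda>z. f z ^ n) = (\<lambda>z. real n * f z ^ (n - 1) * Dop f z)"
proof -
  note fn = poly_on_power[OF assms, of n]
  have "dd (\<lambda>z. f z ^ n) z h = real n * dd f z h * f z ^ (n - 1)" for z h
    by (rule dd_eqI) (intro has_derivative_power poly_on_has_derivative[OF assms])
  then show "pdx1 (\<lambda>z. f z ^ n) = (\<lambda>z. real n * f z ^ (n - 1) * pdx1 f z)"
    "pdx2 (\<lambda>z. f z ^ n) = (\<lambda>z. real n * f z ^ (n - 1) * pdx2 f z)"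
    "pdy1 (\<lambda>z. f z ^ n) = (\<lambda>z. real n * f z ^ (n - 1) * pdy1 f z)"
    "pdy2 (\<lambda>z. f z ^ n) = (\<lambda>z. real n * f z ^ (n - 1) * pdy2 f z)"
    "Dop (\<lambda>z. f z ^ n) = (\<lambda>z. real n * f z ^ (n - 1) * Dop f z)"
    by (simp_all add: fun_eq_iff pd_eq_dd[OF fn] pd_eq_dd[OF assms] Dop_eq_dd[OF fn]
        Dop_eq_dd[OF assms])
qed

lemma pd_mon:
  "pdx1 (mon (a,b,c,d)) = (\<lambda>z. real a * mon (a-1,b,c,d) z)"
  "pdx2 (mon (a,b,c,d)) = (\<lambda>z. real b * mon (a,b-1,c,d) z)"
  "pdy1 (mon (a,b,c,d)) = (\<lambda>z. real c * mon (a,b,c-1,d) z)"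
  "pdy2 (mon (a,b,c,d)) = (\<lambda>z. real d * mon (a,b,c,d-1) z)"
  unfolding pdx1_def pdx2_def pdy1_def pdy2_def
  by (auto simp: fun_eq_iff intro!: DERIV_imp_deriv derivative_eq_intros)

lemma poly_on_pd:
  assumes "poly_on A f" and AB: "\<And>a. Suc a \<in> A \<Longrightarrow> a \<in> B"
  shows "poly_on B (pdx1 f)" "poly_on B (pdx2 f)" "poly_on B (pdy1 f)" "poly_on B (pdy2 f)"
proof -
  have m: "poly_on B (\<lambda>z. e * (real n * mon \<alpha> z))" if "n > 0 \<Longrightarrow> Suc (degm \<alpha>) \<in> A" for e n \<alpha>
    using that AB poly_on_mon[of \<alpha> B "e * real n"] by (cases "n = 0") (auto simp: mult.assoc)
  have "poly_on B (pdx1 f) \<and> poly_on B (pdx2 f) \<and> poly_on B (pdy1 f) \<and> poly_on B (pdy2 f)"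
    using assms(1)
  proof (induction rule: poly_on_induct)
    case zero
    show ?case by (simp add: pd_const)
  next
    case (mon e \<alpha>)
    obtain a b c d where \<alpha>: "\<alpha> = (a,b,c,d)" by (cases \<alpha>)
    have "poly_on {degm \<alpha>} (mon \<alpha>)" using poly_on_mon[of \<alpha> _ 1] by simp
    from pd_cmult[OF this] show ?case
      using mon unfolding \<alpha> by (auto simp: pd_mon intro!: m)
  next
    case (add f g)
    then show ?case by (simp add: pd_add[OF add(1,2)] poly_on_add)
  qed
  then show "poly_on B (pdx1 f)" "poly_on B (pdx2 f)" "poly_on B (pdy1 f)" "poly_on B (pdy2 f)"
    by auto
qed

lemma poly_on_Dop:
  assumes "poly_on A f"
  shows "poly_on A (Dop f)"
proof -
  let ?B = "{a. Suc a \<in> A}"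
  note pd = poly_on_pd[OF assms, of ?B]
  have "poly_on A (\<lambda>z. fst (fst z) * pdy1 f z - fst (snd z) * pdx1 f z
    + snd (fst z) * pdy2 f z - snd (snd z) * pdx2 f z)"
    by (intro poly_on_add poly_on_diff poly_on_mult[OF poly_on_coords(1) pd(3)]
        poly_on_mult[OF poly_on_coords(2) pd(4)] poly_on_mult[OF poly_on_coords(3) pd(1)]
        poly_on_mult[OF poly_on_coords(4) pd(2)]) auto
  then show ?thesis by (simp add: Dop_eq_pd[abs_def])
qed

lemma poly_on_pd_UNIV:
  assumes "poly_on UNIV f"
  shows "poly_on UNIV (pdx1 f)" "poly_on UNIV (pdx2 f)" "poly_on UNIV (pdy1 f)" "poly_on UNIV (pdy2 f)"
  using poly_on_pd[OF assms, of UNIV] by auto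

text \<open>\<open>Dop\<close> has linear coefficients, so its commutator with a
  constant-coefficient derivative has constant coefficients again. Both sides satisfy compatible
  product rules, which reduces the identities to the coordinates.\<close>

lemma Dop_pd_commutator:
  assumes "poly_on D f"
  shows "Dop (pdx1 f) = (\<lambda>z. pdx1 (Dop f) z - pdy1 f z)"
    "Dop (pdx2 f) = (\<lambda>z. pdx2 (Dop f) z - pdy2 f z)"
    "Dop (pdy1 f) = (\<lambda>z. pdy1 (Dop f) z + pdx1 f z)"
    "Dop (pdy2 f) = (\<lambda>z. pdy2 (Dop f) z + pdx2 f z)"
proof -
  let ?P = "\<lambda>f. Dop (pdx1 f) = (\<lambda>z. pdx1 (Dop f) z - pdy1 f z) \<and>
    Dop (pdx2 f) = (\<lambda>z. pdx2 (Dop f) z - pdy2 f z) \<and>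
    Dop (pdy1 f) = (\<lambda>z. pdy1 (Dop f) z + pdx1 f z) \<and>
    Dop (pdy2 f) = (\<lambda>z. pdy2 (Dop f) z + pdx2 f z)"
  have mx: "poly_on UNIV (\<lambda>z. f z * g z)" if "poly_on UNIV f" "poly_on UNIV g" for f g
    using poly_on_mult[OF that] by simp
  have neg: "pdx1 (\<lambda>z. - f z) = (\<lambda>z. - pdx1 f z)" "pdx2 (\<lambda>z. - f z) = (\<lambda>z. - pdx2 f z)"
    "pdy1 (\<lambda>z. - f z) = (\<lambda>z. - pdy1 f z)" "pdy2 (\<lambda>z. - f z) = (\<lambda>z. - pdy2 f z)"
    if "poly_on D f" for D f
    using pd_cmult[OF that, of "-1"] by simp_all
  have "?P f"
    using assms
  proof (induction rule: poly_on_ring_induct)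
    case (add f g)
    note pf = add(1) poly_on_pd_UNIV[OF add(1)] poly_on_Dop[OF add(1)]
    note pg = add(2) poly_on_pd_UNIV[OF add(2)] poly_on_Dop[OF add(2)]
    show ?case
      using add(3,4)
      by (simp add: pd_add[OF pf(1) pg(1)] pd_add[OF pf(2) pg(2)] pd_add[OF pf(3) pg(3)]
          pd_add[OF pf(4) pg(4)] pd_add[OF pf(5) pg(5)] pd_add[OF pf(6) pg(6)] algebra_simps)
  next
    case (mult f g)
    note pf = mult(1) poly_on_pd_UNIV[OF mult(1)] poly_on_Dop[OF mult(1)]
    note pg = mult(2) poly_on_pd_UNIV[OF mult(2)] poly_on_Dop[OF mult(2)]
    note fg = pd_add[OF mx[OF pf(1) pg(2)] mx[OF pf(2) pg(1)]]
      pd_add[OF mx[OF pf(1) pg(3)] mx[OF pf(3) pg(1)]]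
      pd_add[OF mx[OF pf(1) pg(4)] mx[OF pf(4) pg(1)]]
      pd_add[OF mx[OF pf(1) pg(5)] mx[OF pf(5) pg(1)]]
      pd_add[OF mx[OF pf(1) pg(6)] mx[OF pf(6) pg(1)]]
    note ms = pd_mult[OF pf(1) pg(1)]
      pd_mult[OF pf(1) pg(2)] pd_mult[OF pf(1) pg(3)] pd_mult[OF pf(1) pg(4)]
      pd_mult[OF pf(1) pg(5)] pd_mult[OF pf(1) pg(6)]
      pd_mult[OF pf(2) pg(1)] pd_mult[OF pf(3) pg(1)] pd_mult[OF pf(4) pg(1)]
      pd_mult[OF pf(5) pg(1)] pd_mult[OF pf(6) pg(1)]
    show ?case
      using mult(3,4) unfolding ms fg by (simp add: algebra_simps)
  qed (simp_all add: pd_const pd_coords Dop_coords neg[OF poly_on_coords(1)]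
      neg[OF poly_on_coords(2)] neg[OF poly_on_coords(3)] neg[OF poly_on_coords(4)])
  then show "Dop (pdx1 f) = (\<lambda>z. pdx1 (Dop f) z - pdy1 f z)"
    "Dop (pdx2 f) = (\<lambda>z. pdx2 (Dop f) z - pdy2 f z)"
    "Dop (pdy1 f) = (\<lambda>z. pdy1 (Dop f) z + pdx1 f z)"
    "Dop (pdy2 f) = (\<lambda>z. pdy2 (Dop f) z + pdx2 f z)"
    by auto
qed

section \<open>Kernel and image of the rotation operator\<close>

text \<open>The flow of \<open>rotgen\<close>: all planes (x_j, y_j) rotate at once. It has period 2
  \<pi> and is minus the identity at time \<pi>; both facts drive the arguments about the kernel and
  the image.\<close>

definition flow :: "real \<Rightarrow> pt4 \<Rightarrow> pt4" where
  "flow t z = (cos t *\<^sub>R fst z - sin t *\<^sub>R snd z, cos t *\<^sub>R snd z + sin t *\<^sub>R fst z)"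

lemma flow_simps: "flow 0 z = z" "flow (2 * pi) z = z" "flow pi z = - z"
  by (simp_all add: flow_def prod_eq_iff)

lemma flow_has_derivative:
  "((\<lambda>t. flow t z) has_derivative (\<lambda>s. s *\<^sub>R rotgen (flow t z))) (at t)"
  unfolding flow_def rotgen_def
  by (auto intro!: derivative_eq_intros simp: fun_eq_iff prod_eq_iff algebra_simps)

lemma DERIV_flow:
  assumes "poly_on D f"
  shows "((\<lambda>t. f (flow t z)) has_real_derivative Dop f (flow t z)) (at t)"
proof -
  have "((\<lambda>t. f (flow t z)) has_derivative (\<lambda>s. dd f (flow t z) (s *\<^sub>R rotgen (flow t z)))) (at t)"
    using has_derivative_compose[OF flow_has_derivative poly_on_has_derivative[OF assms]] .
  then show ?thesis
    unfolding has_field_derivative_def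
    by (rule has_derivative_eq_rhs)
      (simp add: fun_eq_iff Dop_eq_dd[OF assms] linear_cmul[OF dd_linear[OF assms]])
qed

lemma kernel_flow_invariant:
  assumes "poly_on D f" "Dop f = (\<lambda>z. 0)"
  shows "f (flow t z) = f z"
proof -
  have "\<forall>t. ((\<lambda>t. f (flow t z)) has_real_derivative 0) (at t)"
    using DERIV_flow[OF assms(1)] assms(2) by simp
  from DERIV_isconst_all[OF this, of t 0] show ?thesis
    by (simp add: flow_simps)
qed

text \<open>If \<open>Dop h\<close> is constant along orbits, then \<open>h\<close> grows linearly
  in time with slope \<open>Dop h z\<close>. The orbit closes after time 2 \<pi>, so the slope is
  zero.\<close>

lemma kernel_image_trivial:
  assumes "poly_on D h" "Dop (Dop h) = (\<lambda>z. 0)"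
  shows "Dop h = (\<lambda>z. 0)"
proof
  fix z
  have "((\<lambda>t. h (flow t z) - t * Dop h z) has_real_derivative 0) (at t)" for t
    using DERIV_flow[OF assms(1), of z t]
      kernel_flow_invariant[OF poly_on_Dop[OF assms(1)] assms(2), of t z]
    by (auto intro!: derivative_eq_intros)
  then have "\<forall>t. ((\<lambda>t. h (flow t z) - t * Dop h z) has_real_derivative 0) (at t)"
    by blast
  from DERIV_isconst_all[OF this, of "2 * pi" 0] show "Dop h z = 0"
    by (simp add: flow_simps)
qed

text \<open>Functions in the kernel are constant along the flow, whose time-\<pi> map sends
  \<open>z\<close> to \<open>- z\<close>; an odd function with this invariance vanishes.\<close>

lemma odd_kernel_trivial:
  assumes "poly_on {k} f" "odd k" "Dop f = (\<lambda>z. 0)"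
  shows "f = (\<lambda>z. 0)"
proof
  fix z
  have "f z = f (- z)"
    using kernel_flow_invariant[OF assms(1,3), of pi z] by (simp add: flow_simps)
  also have "f (- z) = - f z"
    using poly_on_scale[OF assms(1), of "-1" z] assms(2) by simp
  finally show "f z = 0" by simp
qed

text \<open>Along the flow line of \<open>(q, 0)\<close> the derivative of a primitive would be
  \<open>cos t ^ n * V q\<close>, which has constant sign, whereas the flow is periodic.\<close>

lemma even_potential_not_image_pos:
  assumes h: "poly_on D h" and "even n"
    and hV: "\<And>z. Dop h z = V (fst z)" and V: "\<And>s q. V (s *\<^sub>R q) = s ^ n * V q"
  shows "V q \<le> 0"
proof (rule ccontr)
  assume pos: "\<not> V q \<le> 0"
  define F where "F t = h (flow t (q, 0))" for t
  have F: "(F has_real_derivative cos t ^ n * V q) (at t)" for t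
    using DERIV_flow[OF h, of "(q,0)" t] unfolding F_def hV
    by (simp add: flow_def V)
  have mono: "F s \<le> F t" if "s \<le> t" for s t
    using F that pos \<open>even n\<close>
    by (intro DERIV_nonneg_imp_nondecreasing[of s t F])
      (auto intro!: exI zero_le_mult_iff[THEN iffD2] simp: zero_le_even_power)
  \<comment> \<open>Monotonicity alone does not contradict periodicity. At \<pi> the derivative is
    strictly positive because \<open>n\<close> is even, so \<open>F\<close> rises just after \<pi>;
    the step \<open>e\<close> is capped by \<pi> to remain within one period.\<close>
  have "cos pi ^ n * V q > 0" using pos \<open>even n\<close> by simp
  from DERIV_pos_inc_right[OF F this] obtain d where
    d: "d > 0" "\<forall>h>0. h < d \<longrightarrow> F pi < F (pi + h)" by blast
  define e where "e = min (d / 2) pi"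
  have e: "0 < e" "e < d" "e \<le> pi" using d by (auto simp: e_def min_def)
  have "F 0 \<le> F pi" "F pi < F (pi + e)" "F (pi + e) \<le> F (2 * pi)"
    using d e by (auto intro: mono)
  moreover have "F (2 * pi) = F 0" by (simp add: F_def flow_simps)
  ultimately show False by simp
qed

lemma even_potential_not_image:
  assumes h: "poly_on D h" and "even n"
    and hV: "\<And>z. Dop h z = V (fst z)" and V: "\<And>s q. V (s *\<^sub>R q) = s ^ n * V q"
  shows "V q = 0"
proof -
  have "V q \<le> 0" by (rule even_potential_not_image_pos[OF assms])
  moreover have "- V q \<le> 0"
    by (rule even_potential_not_image_pos[OF poly_on_minus[OF h] \<open>even n\<close>, of "\<lambda>q. - V q"])
      (simp_all add: Dop_minus[OF h] hV V)
  ultimately show ?thesis by simp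
qed

section \<open>Eigenfunctions of the rotation operator and the splitting into kernel and
  image\<close>

definition lin_eig :: "real \<Rightarrow> (pt4 \<Rightarrow> real) \<Rightarrow> (pt4 \<Rightarrow> real) \<Rightarrow> bool" where
  "lin_eig s u v \<longleftrightarrow> poly_on {1} u \<and> poly_on {1} v \<and>
     Dop u = (\<lambda>z. - s * v z) \<and> Dop v = (\<lambda>z. s * u z)"

text \<open>\<open>eigpair k m R I\<close> says that \<open>R + i I\<close> is a product of \<open>k\<close> factors
  \<open>x\<^sub>j \<plusminus> i y\<^sub>j\<close>, hence an eigenfunction of the rotation operator with eigenvalue \<open>i m\<close>.\<close>

inductive eigpair :: "nat \<Rightarrow> real \<Rightarrow> (pt4 \<Rightarrow> real) \<Rightarrow> (pt4 \<Rightarrow> real) \<Rightarrow> bool" where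
  const: "eigpair 0 0 (\<lambda>z. a) (\<lambda>z. b)"
| step: "eigpair k m R I \<Longrightarrow> lin_eig s u v \<Longrightarrow>
    eigpair (Suc k) (m + s) (\<lambda>z. u z * R z - v z * I z) (\<lambda>z. u z * I z + v z * R z)"

text \<open>In complex notation, \<open>lin_eig s u v\<close> says that \<open>u + i v\<close> is
  linear with eigenvalue \<open>i s\<close>. By the product rule, eigenvalues of the factors add
  up.\<close>

lemma eigpair_Dop:
  assumes "eigpair k m R I"
  shows "poly_on {k} R \<and> poly_on {k} I \<and> Dop R = (\<lambda>z. - m * I z) \<and> Dop I = (\<lambda>z. m * R z)"
  using assms
proof induction
  case (const a b)
  then show ?case by (simp add: poly_on_const pd_const)
next
  case (step k m R I s u v)
  then have R: "poly_on {k} R" "Dop R = (\<lambda>z. - m * I z)" and I: "poly_on {k} I" "Dop I = (\<lambda>z. m * R z)"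
    and u: "poly_on {1} u" "Dop u = (\<lambda>z. - s * v z)" and v: "poly_on {1} v" "Dop v = (\<lambda>z. s * u z)"
    by (auto simp: lin_eig_def)
  have m: "poly_on {Suc k} (\<lambda>z. f z * g z)" if "poly_on {1} f" "poly_on {k} g" for f g
    using poly_on_mult[OF that] by simp
  note p = m[OF u(1) R(1)] m[OF v(1) I(1)] m[OF u(1) I(1)] m[OF v(1) R(1)]
  show ?case
    unfolding Dop_diff[OF p(1,2)] pd_add(5)[OF p(3,4)]
      pd_mult(5)[OF u(1) R(1)] pd_mult(5)[OF v(1) I(1)] pd_mult(5)[OF u(1) I(1)]
      pd_mult(5)[OF v(1) R(1)] R(2) I(2) u(2) v(2)
    by (intro conjI poly_on_diff poly_on_add p) (simp_all add: algebra_simps)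
qed

text \<open>This is multiplication of \<open>R + i I\<close> by the complex constant
  \<open>a + i b\<close>, which can be absorbed into the constant factor at the start of the
  product.\<close>

lemma eigpair_scale:
  assumes "eigpair k m R I"
  shows "eigpair k m (\<lambda>z. a * R z - b * I z) (\<lambda>z. a * I z + b * R z)"
  using assms
proof induction
  case (const c d)
  then show ?case by (rule eigpair.const)
next
  case (step k m R I s u v)
  from eigpair.step[OF step(3,2)] show ?case
    by (simp add: algebra_simps)
qed

text \<open>Sums of real parts suffice: an imaginary part is the real part of the eigenfunction
  multiplied by \<open>- i\<close>.\<close>

inductive eigspan :: "nat \<Rightarrow> (pt4 \<Rightarrow> real) \<Rightarrow> bool" where
  zero: "eigspan k (\<lambda>z. 0)"
| eig: "eigpair k m R I \<Longrightarrow> eigspan k R"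
| add: "eigspan k f \<Longrightarrow> eigspan k g \<Longrightarrow> eigspan k (\<lambda>z. f z + g z)"

text \<open>Each coordinate is a complex combination of two eigenfunctions: \<open>u\<close> is half
  the sum of \<open>u + i v\<close> and \<open>u - i v\<close>, and \<open>v\<close> is their
  difference divided by \<open>2 i\<close>.\<close>

lemma eigspan_mult:
  assumes "eigspan k f" and p: "lin_eig 1 u v" and n: "lin_eig (-1) u (\<lambda>z. - v z)"
  shows "eigspan (Suc k) (\<lambda>z. u z * f z) \<and> eigspan (Suc k) (\<lambda>z. v z * f z)"
  using assms(1)
proof induction
  case (zero k)
  then show ?case by (simp add: eigspan.zero)
next
  case (eig k m R I)
  \<comment> \<open>The real parts of \<open>(a + i b) (u + i v) (R + i I)\<close> and of
    \<open>(a + i b) (u - i v) (R + i I)\<close>. Weights 1/2 and 1/2 give \<open>u R\<close>;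
    weights \<open>- i/2\<close> and \<open>i/2\<close> give \<open>v R\<close>.\<close>
  have P: "eigspan (Suc k) (\<lambda>z. a * (u z * R z - v z * I z) - b * (u z * I z + v z * R z))"
    and N: "eigspan (Suc k) (\<lambda>z. a * (u z * R z + v z * I z) - b * (u z * I z - v z * R z))" for a b
    using eigspan.eig[OF eigpair_scale[OF eigpair.step[OF eig p]], of a b]
      eigspan.eig[OF eigpair_scale[OF eigpair.step[OF eig n]], of a b]
    by (simp_all add: algebra_simps)
  show ?case
    using eigspan.add[OF P[of "1/2" 0] N[of "1/2" 0]]
      eigspan.add[OF P[of 0 "-1/2"] N[of 0 "1/2"]]
    by (simp add: algebra_simps add_divide_distrib[symmetric] diff_divide_distrib[symmetric])
next
  case (add k f g)
  then show ?case
    using eigspan.add by (simp add: distrib_left)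
qed

lemma homog_eigspan:
  assumes "poly_on {k} f"
  shows "eigspan k f"
  using assms
proof (induction rule: poly_on_induct)
  case zero
  show ?case by (rule eigspan.zero)
next
  case (mon c \<alpha>)
  obtain a1 a2 b1 b2 where \<alpha>: "\<alpha> = (a1,a2,b1,b2)" by (cases \<alpha>)
  have L: "lin_eig 1 (\<lambda>z. fst (fst z)) (\<lambda>z. fst (snd z))"
    "lin_eig (-1) (\<lambda>z. fst (fst z)) (\<lambda>z. - fst (snd z))"
    "lin_eig 1 (\<lambda>z. snd (fst z)) (\<lambda>z. snd (snd z))"
    "lin_eig (-1) (\<lambda>z. snd (fst z)) (\<lambda>z. - snd (snd z))"
    using poly_on_coords poly_on_minus[OF poly_on_coords(3)] poly_on_minus[OF poly_on_coords(4)]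
    by (simp_all add: lin_eig_def Dop_coords Dop_minus[OF poly_on_coords(3)]
        Dop_minus[OF poly_on_coords(4)])
  have pow: "eigspan (n + k) (\<lambda>z. u z ^ n * g z)"
    if "\<And>k g. eigspan k g \<Longrightarrow> eigspan (Suc k) (\<lambda>z. u z * g z)" "eigspan k g" for u g n k
    by (induction n) (use that in \<open>auto simp: mult.assoc\<close>)
  note mult = eigspan_mult[OF _ L(1,2)] eigspan_mult[OF _ L(3,4)]
  note mx = mult(1)[THEN conjunct1] mult(2)[THEN conjunct1]
    mult(1)[THEN conjunct2] mult(2)[THEN conjunct2]
  have "eigspan 0 (\<lambda>z. c)" by (rule eigspan.eig[OF eigpair.const])
  then have "eigspan (b2 + 0) (\<lambda>z. snd (snd z) ^ b2 * c)"
    by (rule pow[rotated]) (rule mx(4))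
  then have "eigspan (b1 + (b2 + 0)) (\<lambda>z. fst (snd z) ^ b1 * (snd (snd z) ^ b2 * c))"
    by (rule pow[rotated]) (rule mx(3))
  then have "eigspan (a2 + (b1 + (b2 + 0)))
      (\<lambda>z. snd (fst z) ^ a2 * (fst (snd z) ^ b1 * (snd (snd z) ^ b2 * c)))"
    by (rule pow[rotated]) (rule mx(2))
  then have "eigspan (a1 + (a2 + (b1 + (b2 + 0))))
      (\<lambda>z. fst (fst z) ^ a1 * (snd (fst z) ^ a2 * (fst (snd z) ^ b1 * (snd (snd z) ^ b2 * c))))"
    by (rule pow[rotated]) (rule mx(1))
  moreover have "a1 + (a2 + (b1 + (b2 + 0))) = k" using mon \<alpha> by simp
  ultimately show ?case by (simp add: \<alpha> mon_eq mult_ac)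
next
  case (add f g)
  then show ?case by (intro eigspan.add)
qed

text \<open>\<open>Dop\<close> is diagonalised by the eigenfunctions. With eigenvalue 0 the real
  part lies in the kernel; with \<open>m\<close> nonzero, \<open>Dop I = m R\<close> exhibits
  \<open>R\<close> as the image of \<open>I / m\<close>.\<close>

lemma kernel_image_decomposition:
  assumes "poly_on {k} f"
  obtains g h where "poly_on {k} g" "Dop g = (\<lambda>z. 0)" "poly_on {k} h" "f = (\<lambda>z. g z + Dop h z)"
proof -
  have witness: "\<exists>g h. poly_on {k} g \<and> Dop g = (\<lambda>z. 0) \<and> poly_on {k} h \<and> f = (\<lambda>z. g z + Dop h z)"
    if "poly_on {k} g" "Dop g = (\<lambda>z. 0)" "poly_on {k} h" "f = (\<lambda>z. g z + Dop h z)" for k f g h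
    by (rule exI[of _ g], rule exI[of _ h], intro conjI that)
  have "\<exists>g h. poly_on {k} g \<and> Dop g = (\<lambda>z. 0) \<and> poly_on {k} h \<and> f = (\<lambda>z. g z + Dop h z)"
    using homog_eigspan[OF assms]
  proof induction
    case (zero k)
    show ?case
      by (rule witness[of k "\<lambda>z. 0" "\<lambda>z. 0"]) (simp_all add: pd_const)
  next
    case (eig k m R I)
    note E = eigpair_Dop[OF eig]
    show ?case
    proof (cases "m = 0")
      case True
      then show ?thesis using E
        by (intro witness[of k R "\<lambda>z. 0"]) (simp_all add: pd_const)
    next
      case False
      have "Dop (\<lambda>z. (1 / m) * I z) = R"
        using E pd_cmult(5)[of "{k}" I "1 / m"] False by simp
      then show ?thesis using E poly_on_cmult[of "{k}" I "1 / m"]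
        by (intro witness[of k "\<lambda>z. 0" "\<lambda>z. (1 / m) * I z"]) (simp_all add: pd_const)
    qed
  next
    case (add k f f')
    then obtain g h g' h' where
      g: "poly_on {k} g" "Dop g = (\<lambda>z. 0)" and h: "poly_on {k} h" and f: "f = (\<lambda>z. g z + Dop h z)"
      and g': "poly_on {k} g'" "Dop g' = (\<lambda>z. 0)" and h': "poly_on {k} h'"
      and f': "f' = (\<lambda>z. g' z + Dop h' z)"
      by (elim exE conjE)
    show ?case
    proof (rule witness[of k "\<lambda>z. g z + g' z" "\<lambda>z. h z + h' z"])
      show "Dop (\<lambda>z. g z + g' z) = (\<lambda>z. 0)"
        by (simp add: pd_add(5)[OF g(1) g'(1)] g(2) g'(2))
      show "(\<lambda>z. f z + f' z) = (\<lambda>z. g z + g' z + Dop (\<lambda>z. h z + h' z) z)"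
        unfolding pd_add(5)[OF h h'] f f' by (simp add: algebra_simps)
    qed (intro poly_on_add g g' h h')+
  qed
  then show thesis using that by (elim exE conjE)
qed

text \<open>The kernel component of a preimage can be discarded, leaving a preimage that is itself
  an image. The generating function requires this, since its terms must lie in the image of
  \<open>Dop\<close>.\<close>

lemma image_Dop_square:
  assumes "poly_on {k} f"
  obtains g where "poly_on {k} g" "Dop f = Dop (Dop g)"
proof -
  obtain g h where g: "poly_on {k} g" "Dop g = (\<lambda>z. 0)" and h: "poly_on {k} h"
    and f: "f = (\<lambda>z. g z + Dop h z)"
    using kernel_image_decomposition[OF assms] .
  have "Dop f = Dop (Dop h)"
    unfolding f using pd_add(5)[OF g(1) poly_on_Dop[OF h]] g(2) by simp
  then show thesis using that h by blast
qed

section \<open>The generating function equation, degree by degree\<close>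

text \<open>\<open>f\<close> is the part of \<open>F\<close> of degree \<open>m\<close>, with
  nothing below it; \<open>f\<close> may be zero.\<close>

definition leads :: "nat \<Rightarrow> (pt4 \<Rightarrow> real) \<Rightarrow> (pt4 \<Rightarrow> real) \<Rightarrow> bool" where
  "leads m F f \<longleftrightarrow> poly_on {m} f \<and> poly_on {m<..} (\<lambda>z. F z - f z)"

lemma leads_mult:
  assumes "leads a F f" "leads b H h"
  shows "leads (a + b) (\<lambda>z. F z * H z) (\<lambda>z. f z * h z)"
proof -
  note F = assms(1)[unfolded leads_def] and H = assms(2)[unfolded leads_def]
  have "poly_on {a + b<..} (\<lambda>z. (F z - f z) * (H z - h z) + (F z - f z) * h z + f z * (H z - h z))"
    by (intro poly_on_add poly_on_mult[OF conjunct2[OF F] conjunct2[OF H]]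
        poly_on_mult[OF conjunct2[OF F] conjunct1[OF H]]
        poly_on_mult[OF conjunct1[OF F] conjunct2[OF H]]) auto
  moreover have "poly_on {a + b} (\<lambda>z. f z * h z)"
    using poly_on_mult[OF conjunct1[OF F] conjunct1[OF H]] by simp
  ultimately show ?thesis
    unfolding leads_def by (simp add: algebra_simps)
qed

lemma leads_const: "leads 0 (\<lambda>z. c) (\<lambda>z. c)"
  by (simp add: leads_def poly_on_const)

lemma leads_power:
  assumes "leads 1 F f"
  shows "leads n (\<lambda>z. F z ^ n) (\<lambda>z. f z ^ n)"
proof (induction n)
  case 0
  then show ?case using leads_const[of 1] by simp
next
  case (Suc n)
  then show ?case using leads_mult[OF assms Suc] by simp
qed

text \<open>Moving the position coordinates by terms of degree at least 2 leaves the leading part of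
  each factor unchanged, hence also that of the product.\<close>

lemma shift_mon:
  assumes "poly_on {1<..} P" "poly_on {1<..} Q"
  shows "poly_on {degm \<alpha><..}
    (\<lambda>z. mon \<alpha> ((fst (fst z) + P z, snd (fst z) + Q z), snd z) - mon \<alpha> z)"
proof -
  obtain a b c d where \<alpha>: "\<alpha> = (a,b,c,d)" by (cases \<alpha>)
  have L: "leads 1 (\<lambda>z. fst (fst z) + P z) (\<lambda>z. fst (fst z))"
    "leads 1 (\<lambda>z. snd (fst z) + Q z) (\<lambda>z. snd (fst z))"
    "leads 1 (\<lambda>z. fst (snd z)) (\<lambda>z. fst (snd z))"
    "leads 1 (\<lambda>z. snd (snd z)) (\<lambda>z. snd (snd z))"
    using assms poly_on_coords by (simp_all add: leads_def)
  from leads_mult[OF leads_mult[OF leads_mult[OF leads_power[OF L(1), of a]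
      leads_power[OF L(2), of b]] leads_power[OF L(3), of c]] leads_power[OF L(4), of d]]
  show ?thesis
    by (simp add: leads_def \<alpha> mon_eq)
qed

lemma shift_homog:
  assumes "poly_on {1<..} P" "poly_on {1<..} Q" "poly_on {k} g"
  shows "poly_on {k<..} (\<lambda>z. g ((fst (fst z) + P z, snd (fst z) + Q z), snd z) - g z)"
  using assms(3)
proof (induction rule: poly_on_induct)
  case (mon c \<alpha>)
  from poly_on_cmult[OF shift_mon[OF assms(1,2), of \<alpha>], of c] mon show ?case
    by (simp add: right_diff_distrib)
next
  case (add f g)
  from poly_on_add[OF add.IH] show ?case by (simp add: algebra_simps)
qed simp

lemma shift_higher:
  assumes "poly_on {1<..} P" "poly_on {1<..} Q" "poly_on {k<..} g"
  shows "poly_on {k<..} (\<lambda>z. g ((fst (fst z) + P z, snd (fst z) + Q z), snd z))"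
  using assms(3)
proof (induction rule: poly_on_induct)
  case (mon c \<alpha>)
  have "poly_on {k<..} (\<lambda>z. mon \<alpha> ((fst (fst z) + P z, snd (fst z) + Q z), snd z) - mon \<alpha> z)"
    using mon by (intro poly_on_mono[OF shift_mon[OF assms(1,2)]]) auto
  moreover have "poly_on {k<..} (mon \<alpha>)"
    using poly_on_mon[OF mon, of 1] by simp
  ultimately have "poly_on {k<..} (\<lambda>z. mon \<alpha> ((fst (fst z) + P z, snd (fst z) + Q z), snd z))"
    using poly_on_add by fastforce
  then show ?case by (rule poly_on_cmult)
next
  case (add f g)
  from poly_on_add[OF add.IH] show ?case .
qed simp

section \<open>Expansion of the generating function equation\<close>

definition residual :: "(pt4 \<Rightarrow> real) \<Rightarrow> (pt4 \<Rightarrow> real) \<Rightarrow> (pt4 \<Rightarrow> real) \<Rightarrow> pt4 \<Rightarrow> real" where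
  "residual K G W = (\<lambda>z. K (fst z, (pdx1 W z, pdx2 W z)) - G ((pdy1 W z, pdy2 W z), snd z))"

text \<open>The quadratic contribution of a term \<open>A\<close> of the generating function to the
  equation; for \<open>A\<close> of degree \<open>d\<close> it first enters in degree
  \<open>2 * d - 2\<close>.\<close>

definition grad_diff :: "(pt4 \<Rightarrow> real) \<Rightarrow> pt4 \<Rightarrow> real" where
  "grad_diff A z = ((pdx1 A z)\<^sup>2 + (pdx2 A z)\<^sup>2 - (pdy1 A z)\<^sup>2 - (pdy2 A z)\<^sup>2) / 2"

lemma grad_diff_zero [simp]: "grad_diff (\<lambda>z. 0) = (\<lambda>z. 0)"
  by (simp add: grad_diff_def pd_const fun_eq_iff)

lemma poly_on_grad_diff:
  assumes "poly_on {d} A"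
  shows "poly_on {2 * d - 2} (grad_diff A)"
proof -
  note pd = poly_on_pd[OF assms, of "{a. Suc a = d}"]
  show ?thesis
    unfolding grad_diff_def power2_eq_square
    by (intro poly_on_divide poly_on_add poly_on_diff poly_on_mult[OF pd(1) pd(1)]
        poly_on_mult[OF pd(2) pd(2)] poly_on_mult[OF pd(3) pd(3)] poly_on_mult[OF pd(4) pd(4)]) auto
qed

text \<open>For W = q.eta + S, the two harmonic parts contribute exactly
  \<open>- Dop S + grad_diff S\<close>. Here S = A + w + B, with \<open>A\<close> a term already
  known, and beyond \<open>A\<close> only \<open>w\<close> and \<open>g\<close> are visible up to
  degree \<open>k\<close>.\<close>

lemma residual_expansion:
  assumes A: "poly_on {d} A" and "3 \<le> d" "3 \<le> k"
    and w: "poly_on {k} w" and B: "poly_on {k<..} B" and g: "poly_on {k} g" and R: "poly_on {k<..} R"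
    and W: "W = (\<lambda>z. fst (fst z) * fst (snd z) + snd (fst z) * snd (snd z) + (A z + (w z + B z)))"
    and G: "G = (\<lambda>z. harm z + (g z + R z))"
  shows "poly_on {k<..} (\<lambda>z. residual (\<lambda>z. harm z + V (fst z)) G W z -
    (V (fst z) - Dop A z + grad_diff A z - Dop w z - g z))"
proof -
  define u where "u z = w z + B z" for z
  have u: "poly_on {k..} u"
    unfolding u_def
    by (intro poly_on_add poly_on_mono[OF w] poly_on_mono[OF B]) auto
  have qe: "poly_on UNIV (\<lambda>z. fst (fst z) * fst (snd z))" "poly_on UNIV (\<lambda>z. snd (fst z) * snd (snd z))"
    by (rule poly_on_mult[OF poly_on_coords(1) poly_on_coords(3)]
        poly_on_mult[OF poly_on_coords(2) poly_on_coords(4)], simp)+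
  have Au: "poly_on UNIV (\<lambda>z. A z + u z)"
    by (intro poly_on_add poly_on_mono[OF A] poly_on_mono[OF u]) auto
  have W': "W = (\<lambda>z. (fst (fst z) * fst (snd z) + snd (fst z) * snd (snd z)) + (A z + u z))"
    by (simp add: W u_def)
  note pd_simps = pd_add[OF poly_on_add[OF qe] Au] pd_add[OF qe] pd_add[OF A u]
    pd_mult[OF poly_on_coords(1) poly_on_coords(3)] pd_mult[OF poly_on_coords(2) poly_on_coords(4)]
    pd_coords
  have pdW: "pdx1 W z = fst (snd z) + (pdx1 A z + pdx1 u z)"
    "pdx2 W z = snd (snd z) + (pdx2 A z + pdx2 u z)"
    "pdy1 W z = fst (fst z) + (pdy1 A z + pdy1 u z)"
    "pdy2 W z = snd (fst z) + (pdy2 A z + pdy2 u z)" for z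
    unfolding W' pd_simps by simp_all
  have Du: "Dop u z = Dop w z + Dop B z" for z
    unfolding u_def using pd_add(5)[OF w B] by simp
  have pA: "poly_on {d - 1} (pdx1 A)" "poly_on {d - 1} (pdx2 A)"
    "poly_on {d - 1} (pdy1 A)" "poly_on {d - 1} (pdy2 A)"
    by (intro poly_on_pd[OF A]; auto)+
  have pu: "poly_on {k - 1..} (pdx1 u)" "poly_on {k - 1..} (pdx2 u)"
    "poly_on {k - 1..} (pdy1 u)" "poly_on {k - 1..} (pdy2 u)"
    by (intro poly_on_pd[OF u]; auto)+
  let ?P = "\<lambda>z. pdy1 A z + pdy1 u z" and ?Q = "\<lambda>z. pdy2 A z + pdy2 u z"
  have P: "poly_on {1<..} ?P" and Q: "poly_on {1<..} ?Q"
    using \<open>3 \<le> d\<close> \<open>3 \<le> k\<close>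
    by (intro poly_on_add poly_on_mono[OF pA(3)] poly_on_mono[OF pA(4)]
        poly_on_mono[OF pu(3)] poly_on_mono[OF pu(4)]; auto)+
  have Au': "poly_on {k<..} (\<lambda>z. f z * h z)" if "poly_on {d - 1} f" "poly_on {k - 1..} h" for f h
    using \<open>3 \<le> d\<close> \<open>3 \<le> k\<close> by (intro poly_on_mult[OF that]) auto
  have uu: "poly_on {k<..} (\<lambda>z. f z * h z)" if "poly_on {k - 1..} f" "poly_on {k - 1..} h" for f h
    using \<open>3 \<le> k\<close> by (intro poly_on_mult[OF that]) auto
  have h: "harm (q, p) = (fst p ^ 2 + fst q ^ 2 + snd p ^ 2 + snd q ^ 2) / 2" for q p
    by (cases q; cases p) simp
  \<comment> \<open>The point (dW/deta, eta) at which \<open>G\<close> is evaluated, seen as a shift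
    of \<open>z\<close> by terms of degree at least 2.\<close>
  let ?sh = "\<lambda>z. ((fst (fst z) + ?P z, snd (fst z) + ?Q z), snd z)"
  \<comment> \<open>The exact remainder. Products of gradients of \<open>A\<close> and
    \<open>u\<close> have degree at least \<open>(d - 1) + (k - 1)\<close>, above \<open>k\<close>
    as \<open>d\<close> is at least 3; those of \<open>u\<close> with itself have degree at least
    \<open>2 * (k - 1)\<close>, above \<open>k\<close> as \<open>k\<close> is at least 3.\<close>
  have "poly_on {k<..} (\<lambda>z. - Dop B z
      + (pdx1 A z * pdx1 u z + pdx2 A z * pdx2 u z - pdy1 A z * pdy1 u z - pdy2 A z * pdy2 u z)
      + (pdx1 u z * pdx1 u z + pdx2 u z * pdx2 u z - pdy1 u z * pdy1 u z - pdy2 u z * pdy2 u z) / 2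
      - (g (?sh z) - g z) - R (?sh z))"
    by (intro poly_on_diff poly_on_add poly_on_divide poly_on_minus poly_on_Dop B Au' uu pA pu
        shift_homog[OF P Q g] shift_higher[OF P Q R])
  moreover have "residual (\<lambda>z. harm z + V (fst z)) G W z -
      (V (fst z) - Dop A z + grad_diff A z - Dop w z - g z)
    = - Dop B z
      + (pdx1 A z * pdx1 u z + pdx2 A z * pdx2 u z - pdy1 A z * pdy1 u z - pdy2 A z * pdy2 u z)
      + (pdx1 u z * pdx1 u z + pdx2 u z * pdx2 u z - pdy1 u z * pdy1 u z - pdy2 u z * pdy2 u z) / 2
      - (g (?sh z) - g z) - R (?sh z)" for z
  proof -
    have "Dop w z = Dop u z - Dop B z" using Du by simp
    then show ?thesis
      unfolding residual_def G pdW h grad_diff_def Dop_eq_pd[of A] Dop_eq_pd[of u]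
      by (simp add: power2_eq_square field_simps)
  qed
  ultimately show ?thesis by (simp only:)
qed

lemma residual_expansion_sum:
  assumes A: "poly_on {d} A" and d: "3 \<le> d" and k: "3 \<le> k" "k \<le> \<rho>"
    and Wk: "\<And>j. j \<in> {k..\<rho>} \<Longrightarrow> poly_on {j} (Wk j)" and Gk: "\<And>j. j \<in> {k..\<rho>} \<Longrightarrow> poly_on {j} (Gk j)"
    and W: "W = (\<lambda>z. fst (fst z) * fst (snd z) + snd (fst z) * snd (snd z) + (A z + (\<Sum>j=k..\<rho>. Wk j z)))"
    and G: "G = (\<lambda>z. harm z + (\<Sum>j=k..\<rho>. Gk j z))"
  shows "poly_on {k<..} (\<lambda>z. residual (\<lambda>z. harm z + V (fst z)) G W z -
    (V (fst z) - Dop A z + grad_diff A z - Dop (Wk k) z - Gk k z))"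
proof (rule residual_expansion[OF A d k(1)])
  show "poly_on {k} (Wk k)" "poly_on {k} (Gk k)"
    using k Wk Gk by auto
  show "poly_on {k<..} (\<lambda>z. \<Sum>j=Suc k..\<rho>. Wk j z)" "poly_on {k<..} (\<lambda>z. \<Sum>j=Suc k..\<rho>. Gk j z)"
    by (intro poly_on_sum poly_on_mono[OF Wk] poly_on_mono[OF Gk]; auto)+
  show "W = (\<lambda>z. fst (fst z) * fst (snd z) + snd (fst z) * snd (snd z) +
      (A z + (Wk k z + (\<Sum>j=Suc k..\<rho>. Wk j z))))"
    using k by (simp add: W sum.atLeast_Suc_atMost)
  show "G = (\<lambda>z. harm z + (Gk k z + (\<Sum>j=Suc k..\<rho>. Gk j z)))"
    using k by (simp add: G sum.atLeast_Suc_atMost)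
qed

text \<open>\<open>A\<close> collects what is known of the generating function and \<open>F\<close>
  is the resulting source term. Below degree \<open>n\<close> there is no source, so each equation
  reads \<open>Gk m + Dop (Wk m) = 0\<close> and forces both unknowns to vanish; the first
  nontrivial equation is the one in degree \<open>n\<close>.\<close>

lemma generating_function_lowest_degree:
  assumes A: "poly_on {d} A" and d: "3 \<le> d" and a: "3 \<le> a" "a \<le> n" "n \<le> \<rho>"
    and F: "F = (\<lambda>z. V (fst z) - Dop A z + grad_diff A z)" and Fn: "poly_on {n} F"
    and Gk: "\<And>j. j \<in> {a..\<rho>} \<Longrightarrow> poly_on {j} (Gk j)" "\<And>j. j \<in> {a..\<rho>} \<Longrightarrow> Dop (Gk j) = (\<lambda>z. 0)"
    and Wk: "\<And>j. j \<in> {a..\<rho>} \<Longrightarrow> \<exists>g. poly_on {j} g \<and> Wk j = Dop g"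
    and W: "W = (\<lambda>z. fst (fst z) * fst (snd z) + snd (fst z) * snd (snd z) + (A z + (\<Sum>j=a..\<rho>. Wk j z)))"
    and G: "G = (\<lambda>z. harm z + (\<Sum>j=a..\<rho>. Gk j z))"
    and res: "poly_on {\<rho><..} (residual (\<lambda>z. harm z + V (fst z)) G W)"
  shows "\<And>k. k \<in> {a..<n} \<Longrightarrow> Gk k = (\<lambda>z. 0) \<and> Wk k = (\<lambda>z. 0)"
    and "F = (\<lambda>z. Gk n z + Dop (Wk n) z)"
proof -
  have pW: "poly_on {j} (Wk j)" if "j \<in> {a..\<rho>}" for j
    using Wk[OF that] poly_on_Dop by auto
  have key: "poly_on {m<..} (\<lambda>z. F z - (Gk m z + Dop (Wk m) z))"
    if m: "a \<le> m" "m \<le> n" and zero: "\<And>k. k \<in> {a..<m} \<Longrightarrow> Gk k = (\<lambda>z. 0) \<and> Wk k = (\<lambda>z. 0)" for m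
  proof -
    have split: "(\<Sum>j=a..\<rho>. f j z) = (\<Sum>j=m..\<rho>. f j z)"
      if "\<And>k. k \<in> {a..<m} \<Longrightarrow> f k = (\<lambda>z. 0)" for f :: "nat \<Rightarrow> pt4 \<Rightarrow> real" and z
      using m a that by (intro sum.mono_neutral_right) auto
    have sums: "(\<Sum>j=a..\<rho>. Wk j z) = (\<Sum>j=m..\<rho>. Wk j z)"
      "(\<Sum>j=a..\<rho>. Gk j z) = (\<Sum>j=m..\<rho>. Gk j z)" for z
      using zero by (auto intro!: split)
    have "poly_on {m<..} (\<lambda>z. residual (\<lambda>z. harm z + V (fst z)) G W z -
        (V (fst z) - Dop A z + grad_diff A z - Dop (Wk m) z - Gk m z))"
      using m a
      by (intro residual_expansion_sum[OF A d, of m \<rho> Wk Gk] pW Gk(1))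
        (auto simp: W G sums)
    moreover have "poly_on {m<..} (residual (\<lambda>z. harm z + V (fst z)) G W)"
      using m a by (intro poly_on_mono[OF res]) auto
    ultimately have "poly_on {m<..} (\<lambda>z. residual (\<lambda>z. harm z + V (fst z)) G W z -
      (residual (\<lambda>z. harm z + V (fst z)) G W z -
        (V (fst z) - Dop A z + grad_diff A z - Dop (Wk m) z - Gk m z)))"
      by (rule poly_on_diff[rotated])
    then show ?thesis by (simp add: F algebra_simps)
  qed
  show zero: "Gk k = (\<lambda>z. 0) \<and> Wk k = (\<lambda>z. 0)" if "k \<in> {a..<n}" for k
    using that
  proof (induction k rule: less_induct)
    case (less m)
    then have m: "a \<le> m" "m < n" "m \<in> {a..\<rho>}" using a by auto
    obtain w where w: "poly_on {m} w" "Wk m = Dop w" using Wk[OF m(3)] by blast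
    let ?S = "\<lambda>z. Gk m z + Dop (Wk m) z"
    have "poly_on {m<..} (\<lambda>z. F z - (F z - ?S z))"
    proof (rule poly_on_diff)
      show "poly_on {m<..} F" using m by (intro poly_on_mono[OF Fn]) auto
      show "poly_on {m<..} (\<lambda>z. F z - ?S z)" using m less by (intro key) auto
    qed
    then have "poly_on {m<..} ?S" by simp
    moreover have "poly_on {m} ?S"
      by (intro poly_on_add Gk(1) poly_on_Dop pW m)
    ultimately have "?S = (\<lambda>z. 0)" by (intro homog_higher_order_zero)
    \<comment> \<open>\<open>Gk m\<close> now lies in both the kernel and the image of
      \<open>Dop\<close>, so \<open>Dop (Wk m)\<close> vanishes. As \<open>Wk m\<close> is itself an
      image, the same argument applied once more makes it vanish.\<close>
    then have GW: "Gk m = (\<lambda>z. - Dop (Wk m) z)" by (simp add: fun_eq_iff eq_neg_iff_add_eq_0)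
    have "(\<lambda>z. - Dop (Dop (Wk m)) z) = (\<lambda>z. 0)"
      using Gk(2)[OF m(3)] unfolding GW Dop_minus[OF poly_on_Dop[OF pW[OF m(3)]]] .
    then have "Dop (Dop (Wk m)) = (\<lambda>z. 0)" by (simp add: fun_eq_iff)
    then have DW: "Dop (Wk m) = (\<lambda>z. 0)" by (rule kernel_image_trivial[OF pW[OF m(3)]])
    then have "Wk m = (\<lambda>z. 0)"
      using kernel_image_trivial[OF w(1)] w(2) by simp
    with DW GW show ?case by simp
  qed
  have "poly_on {n} (\<lambda>z. F z - (Gk n z + Dop (Wk n) z))"
    using a by (intro poly_on_diff poly_on_add Fn Gk(1) poly_on_Dop pW) auto
  moreover have "poly_on {n<..} (\<lambda>z. F z - (Gk n z + Dop (Wk n) z))"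
    using a zero by (intro key) auto
  ultimately have "(\<lambda>z. F z - (Gk n z + Dop (Wk n) z)) = (\<lambda>z. 0)"
    by (rule homog_higher_order_zero)
  then show "F = (\<lambda>z. Gk n z + Dop (Wk n) z)" by (simp add: fun_eq_iff)
qed

section \<open>Kernel components and the normal forms of both Hamiltonians\<close>

definition kernel_part :: "nat \<Rightarrow> (pt4 \<Rightarrow> real) \<Rightarrow> (pt4 \<Rightarrow> real) \<Rightarrow> bool" where
  "kernel_part k F g \<longleftrightarrow> poly_on {k} g \<and> Dop g = (\<lambda>z. 0) \<and>
     (\<exists>h. poly_on {k} h \<and> F = (\<lambda>z. g z + Dop h z))"

lemma kernel_part_exists: "poly_on {k} F \<Longrightarrow> \<exists>g. kernel_part k F g"
  unfolding kernel_part_def by (erule kernel_image_decomposition) blast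

text \<open>The added image is absorbed into the image component; the converse adds the image of
  \<open>- h\<close>.\<close>

lemma kernel_part_add_image:
  assumes "poly_on {k} h"
  shows "kernel_part k (\<lambda>z. F z + Dop h z) g \<longleftrightarrow> kernel_part k F g"
proof -
  have *: "kernel_part k (\<lambda>z. F z + Dop h z) g" if K: "kernel_part k F g" and h: "poly_on {k} h" for F h
  proof -
    obtain h' where h': "poly_on {k} h'" "F = (\<lambda>z. g z + Dop h' z)"
      using K unfolding kernel_part_def by (elim exE conjE)
    have "(\<lambda>z. F z + Dop h z) = (\<lambda>z. g z + Dop (\<lambda>z. h' z + h z) z)"
      unfolding pd_add(5)[OF h'(1) h] h'(2) by (simp add: add.assoc)
    with poly_on_add[OF h'(1) h] K show ?thesis
      unfolding kernel_part_def by (intro conjI exI[of _ "\<lambda>z. h' z + h z"]) auto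
  qed
  show ?thesis
    using *[of F h] *[of "\<lambda>z. F z + Dop h z" "\<lambda>z. - h z"] assms
      poly_on_minus[OF assms] Dop_minus[OF assms] by auto
qed

lemma is_BGNF_iff_residual:
  "is_BGNF \<rho> K G \<longleftrightarrow> (\<exists>Gk Wk.
     (\<forall>k\<in>{3..\<rho>}. poly_on {k} (Gk k) \<and> Dop (Gk k) = (\<lambda>z. 0)) \<and>
     (\<forall>k\<in>{3..\<rho>}. \<exists>g. poly_on {k} g \<and> Wk k = Dop g) \<and>
     G = (\<lambda>z. harm z + (\<Sum>k=3..\<rho>. Gk k z)) \<and>
     poly_on {\<rho><..} (residual K G (\<lambda>z. fst (fst z) * fst (snd z) + snd (fst z) * snd (snd z)
                   + (\<Sum>k=3..\<rho>. Wk k z))))"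
  unfolding is_BGNF_def Let_def residual_def no_terms_le_iff_poly_on homog_iff_poly_on ..

text \<open>An explicit generating function: \<open>Dop a\<close> in degree \<open>d\<close>, an
  image in degree \<open>\<rho>\<close>, and zero in all other degrees. The hypothesis on the kernel
  part includes that the source term is already homogeneous of degree \<open>\<rho>\<close>.\<close>

lemma is_BGNF_intro:
  assumes a: "poly_on {d} a" and d: "3 \<le> d" "d < \<rho>"
    and F: "kernel_part \<rho> (\<lambda>z. V (fst z) - Dop (Dop a) z + grad_diff (Dop a) z) g"
  shows "is_BGNF \<rho> (\<lambda>z. harm z + V (fst z)) (\<lambda>z. harm z + g z)"
proof -
  obtain h0 where g: "poly_on {\<rho>} g" "Dop g = (\<lambda>z. 0)" and h0: "poly_on {\<rho>} h0"
    and F0: "(\<lambda>z. V (fst z) - Dop (Dop a) z + grad_diff (Dop a) z) = (\<lambda>z. g z + Dop h0 z)"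
    using F unfolding kernel_part_def by (elim exE conjE)
  \<comment> \<open>\<open>h0\<close> need not be an image, so it is replaced by
    \<open>Dop h\<close>, which has the same image under \<open>Dop\<close>.\<close>
  obtain h where h: "poly_on {\<rho>} h" "Dop h0 = Dop (Dop h)"
    using image_Dop_square[OF h0] .
  define Gk where "Gk k = (if k = \<rho> then g else (\<lambda>z. 0))" for k
  define hk where "hk k = (if k = \<rho> then h else if k = d then a else (\<lambda>z. 0))" for k
  define W where "W z = fst (fst z) * fst (snd z) + snd (fst z) * snd (snd z)
    + (\<Sum>k=3..\<rho>. Dop (hk k) z)" for z
  have sG: "(\<Sum>k=3..\<rho>. Gk k z) = g z" for z
    using d by (simp add: Gk_def if_distribR sum.delta)
  have "(\<Sum>k=3..\<rho>. Dop (hk k) z) = (\<Sum>k\<in>{d,\<rho>}. Dop (hk k) z)" for z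
    using d by (intro sum.mono_neutral_right) (auto simp: hk_def pd_const)
  then have W: "W = (\<lambda>z. fst (fst z) * fst (snd z) + snd (fst z) * snd (snd z)
      + (Dop a z + (Dop h z + 0)))"
    using d by (simp add: W_def[abs_def] hk_def)
  let ?E = "residual (\<lambda>z. harm z + V (fst z)) (\<lambda>z. harm z + g z) W"
  have "poly_on {\<rho><..} (\<lambda>z. ?E z - (V (fst z) - Dop (Dop a) z + grad_diff (Dop a) z - Dop (Dop h) z - g z))"
    by (rule residual_expansion[OF poly_on_Dop[OF a] d(1) _ poly_on_Dop[OF h(1)] _ g(1) _ W])
      (use d in auto)
  moreover have "V (fst z) - Dop (Dop a) z + grad_diff (Dop a) z - Dop (Dop h) z - g z = 0" for z
    using fun_cong[OF F0, of z] h(2) by simp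
  ultimately have res: "poly_on {\<rho><..} ?E" by simp
  show ?thesis
    unfolding is_BGNF_iff_residual
  proof (intro exI conjI)
    show "\<forall>k\<in>{3..\<rho>}. poly_on {k} (Gk k) \<and> Dop (Gk k) = (\<lambda>z. 0)"
      using g by (auto simp: Gk_def pd_const)
    show "\<forall>k\<in>{3..\<rho>}. \<exists>g. poly_on {k} g \<and> Dop (hk k) = Dop g"
    proof
      fix k
      have "poly_on {k} (hk k)" using h a by (simp add: hk_def)
      then show "\<exists>g. poly_on {k} g \<and> Dop (hk k) = Dop g" by blast
    qed
    show "(\<lambda>z. harm z + g z) = (\<lambda>z. harm z + (\<Sum>k=3..\<rho>. Gk k z))"
      by (simp add: sG)
    show "poly_on {\<rho><..} (residual (\<lambda>z. harm z + V (fst z)) (\<lambda>z. harm z + g z)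
        (\<lambda>z. fst (fst z) * fst (snd z) + snd (fst z) * snd (snd z) + (\<Sum>k=3..\<rho>. Dop (hk k) z)))"
      using res unfolding W_def[abs_def] .
  qed
qed

lemma is_BGNF_elim:
  assumes "is_BGNF \<rho> K G"
  obtains Gk Wk where "\<And>k. k \<in> {3..\<rho>} \<Longrightarrow> poly_on {k} (Gk k)"
    "\<And>k. k \<in> {3..\<rho>} \<Longrightarrow> Dop (Gk k) = (\<lambda>z. 0)"
    "\<And>k. k \<in> {3..\<rho>} \<Longrightarrow> \<exists>g. poly_on {k} g \<and> Wk k = Dop g"
    "G = (\<lambda>z. harm z + (\<Sum>k=3..\<rho>. Gk k z))"
    "poly_on {\<rho><..} (residual K G (\<lambda>z. fst (fst z) * fst (snd z) + snd (fst z) * snd (snd z)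
                   + (\<Sum>k=3..\<rho>. Wk k z)))"
proof -
  obtain Gk Wk where "\<forall>k\<in>{3..\<rho>}. poly_on {k} (Gk k) \<and> Dop (Gk k) = (\<lambda>z. 0)"
     "\<forall>k\<in>{3..\<rho>}. \<exists>g. poly_on {k} g \<and> Wk k = Dop g"
     "G = (\<lambda>z. harm z + (\<Sum>k=3..\<rho>. Gk k z))"
    "poly_on {\<rho><..} (residual K G (\<lambda>z. fst (fst z) * fst (snd z) + snd (fst z) * snd (snd z)
                   + (\<Sum>k=3..\<rho>. Wk k z)))"
    using assms unfolding is_BGNF_iff_residual by (elim exE conjE)
  then show thesis
    by (intro that[of Gk Wk]) auto
qed

text \<open>The potential enters only in the last degree considered, so every earlier term vanishes
  and the last equation splits it into kernel and image.\<close>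

lemma is_BGNF_top_degree:
  assumes "4 \<le> \<rho>" and V: "poly_on {\<rho>} (\<lambda>z. V (fst z))"
  shows "is_BGNF \<rho> (\<lambda>z. harm z + V (fst z)) G \<longleftrightarrow>
    (\<exists>g. kernel_part \<rho> (\<lambda>z. V (fst z)) g \<and> G = (\<lambda>z. harm z + g z))"
proof
  assume "is_BGNF \<rho> (\<lambda>z. harm z + V (fst z)) G"
  then obtain Gk Wk where
    Gk: "\<And>k. k \<in> {3..\<rho>} \<Longrightarrow> poly_on {k} (Gk k)" "\<And>k. k \<in> {3..\<rho>} \<Longrightarrow> Dop (Gk k) = (\<lambda>z. 0)" and
    Wk: "\<And>k. k \<in> {3..\<rho>} \<Longrightarrow> \<exists>g. poly_on {k} g \<and> Wk k = Dop g" and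
    G: "G = (\<lambda>z. harm z + (\<Sum>k=3..\<rho>. Gk k z))" and
    res: "poly_on {\<rho><..} (residual (\<lambda>z. harm z + V (fst z)) G
      (\<lambda>z. fst (fst z) * fst (snd z) + snd (fst z) * snd (snd z) + (\<Sum>k=3..\<rho>. Wk k z)))"
    using is_BGNF_elim by blast
  have F: "(\<lambda>z. V (fst z)) = (\<lambda>z. V (fst z) - Dop (\<lambda>z. 0) z + grad_diff (\<lambda>z. 0) z)"
    by (simp add: pd_const)
  have W: "(\<lambda>z. fst (fst z) * fst (snd z) + snd (fst z) * snd (snd z) + (\<Sum>k=3..\<rho>. Wk k z))
    = (\<lambda>z::pt4. fst (fst z) * fst (snd z) + snd (fst z) * snd (snd z) + (0 + (\<Sum>k=3..\<rho>. Wk k z)))"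
    by simp
  \<comment> \<open>Nothing is known yet: the known term is 0, regarded as homogeneous of degree
    3.\<close>
  note low = generating_function_lowest_degree[OF poly_on_zero order_refl order_refl _ order_refl F V Gk Wk W G res]
  have "(\<Sum>k=3..\<rho>. Gk k z) = (\<Sum>k\<in>{\<rho>}. Gk k z)" for z
    using assms(1) low(1) by (intro sum.mono_neutral_right) auto
  then have "G = (\<lambda>z. harm z + Gk \<rho> z)" using G by simp
  moreover have "kernel_part \<rho> (\<lambda>z. V (fst z)) (Gk \<rho>)"
    unfolding kernel_part_def using Gk[of \<rho>] Wk[of \<rho>] low(2) assms(1) poly_on_Dop
    by (intro conjI exI[of _ "Wk \<rho>"]) auto
  ultimately show "\<exists>g. kernel_part \<rho> (\<lambda>z. V (fst z)) g \<and> G = (\<lambda>z. harm z + g z)"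
    by blast
next
  assume "\<exists>g. kernel_part \<rho> (\<lambda>z. V (fst z)) g \<and> G = (\<lambda>z. harm z + g z)"
  then show "is_BGNF \<rho> (\<lambda>z. harm z + V (fst z)) G"
    using is_BGNF_intro[of 3 "\<lambda>z. 0" \<rho> V] assms by (auto simp: pd_const)
qed

text \<open>The equations are solved in two passes. The first, up to degree \<open>d\<close>,
  determines \<open>Wk d = Dop a\<close> and \<open>Gk d = 0\<close>; the second takes
  \<open>Dop a\<close> as the known term, and its source \<open>grad_diff (Dop a)\<close> has degree
  \<open>2 * d - 2\<close>.\<close>

lemma is_BGNF_second_order:
  assumes "odd d" "3 \<le> d" and a: "poly_on {d} a" and V: "(\<lambda>z. V (fst z)) = Dop (Dop a)"
  shows "is_BGNF (2 * d - 2) (\<lambda>z. harm z + V (fst z)) G \<longleftrightarrow>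
    (\<exists>g. kernel_part (2 * d - 2) (grad_diff (Dop a)) g \<and> G = (\<lambda>z. harm z + g z))"
proof -
  define \<rho> where "\<rho> = 2 * d - 2"
  have \<rho>: "d < \<rho>" using \<open>3 \<le> d\<close> by (simp add: \<rho>_def)
  have A: "poly_on {d} (Dop a)" by (rule poly_on_Dop[OF a])
  have F: "grad_diff (Dop a) = (\<lambda>z. V (fst z) - Dop (Dop a) z + grad_diff (Dop a) z)"
    unfolding V[symmetric] by simp
  have "is_BGNF \<rho> (\<lambda>z. harm z + V (fst z)) G \<longleftrightarrow>
    (\<exists>g. kernel_part \<rho> (grad_diff (Dop a)) g \<and> G = (\<lambda>z. harm z + g z))"
  proof
    assume "is_BGNF \<rho> (\<lambda>z. harm z + V (fst z)) G"
    then obtain Gk Wk where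
      Gk: "\<And>k. k \<in> {3..\<rho>} \<Longrightarrow> poly_on {k} (Gk k)" "\<And>k. k \<in> {3..\<rho>} \<Longrightarrow> Dop (Gk k) = (\<lambda>z. 0)" and
      Wk: "\<And>k. k \<in> {3..\<rho>} \<Longrightarrow> \<exists>g. poly_on {k} g \<and> Wk k = Dop g" and
      G: "G = (\<lambda>z. harm z + (\<Sum>k=3..\<rho>. Gk k z))" and
      res: "poly_on {\<rho><..} (residual (\<lambda>z. harm z + V (fst z)) G
        (\<lambda>z. fst (fst z) * fst (snd z) + snd (fst z) * snd (snd z) + (\<Sum>k=3..\<rho>. Wk k z)))"
      using is_BGNF_elim by blast
    have F0: "(\<lambda>z. V (fst z)) = (\<lambda>z. V (fst z) - Dop (\<lambda>z. 0) z + grad_diff (\<lambda>z. 0) z)"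
      by (simp add: pd_const)
    have Vd: "poly_on {d} (\<lambda>z. V (fst z))" unfolding V by (intro poly_on_Dop a)
    have W0: "(\<lambda>z. fst (fst z) * fst (snd z) + snd (fst z) * snd (snd z) + (\<Sum>k=3..\<rho>. Wk k z))
      = (\<lambda>z::pt4. fst (fst z) * fst (snd z) + snd (fst z) * snd (snd z) + (0 + (\<Sum>k=3..\<rho>. Wk k z)))"
      by simp
    note low = generating_function_lowest_degree[OF poly_on_zero order_refl order_refl \<open>3 \<le> d\<close>
        less_imp_le[OF \<rho>] F0 Vd Gk Wk W0 G res]
    have dd: "d \<in> {3..\<rho>}" using \<rho> \<open>3 \<le> d\<close> by simp
    have Gd: "Gk d = (\<lambda>z. 0)"
      by (rule odd_kernel_trivial[OF Gk(1)[OF dd] \<open>odd d\<close> Gk(2)[OF dd]])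
    have pWd: "poly_on {d} (Wk d)" using Wk[OF dd] poly_on_Dop by auto
    \<comment> \<open>Both functions are mapped by \<open>Dop\<close> to the potential, and
      \<open>Dop\<close> is injective in odd degree.\<close>
    have "Dop (\<lambda>z. Wk d z - Dop a z) = (\<lambda>z. 0)"
      using low(2) unfolding Dop_diff[OF pWd A] V Gd by (simp add: fun_eq_iff)
    then have "(\<lambda>z. Wk d z - Dop a z) = (\<lambda>z. 0)"
      by (intro odd_kernel_trivial[OF poly_on_diff[OF pWd A] \<open>odd d\<close>])
    then have Wd: "Wk d = Dop a" by (simp add: fun_eq_iff)
    have split: "(\<Sum>k=3..\<rho>. f k z) = f d z + (\<Sum>k=Suc d..\<rho>. f k z)"
      if "\<And>k. k \<in> {3..<d} \<Longrightarrow> f k = (\<lambda>z. 0)" for f :: "nat \<Rightarrow> pt4 \<Rightarrow> real" and z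
    proof -
      have "(\<Sum>k=3..\<rho>. f k z) = (\<Sum>k=d..\<rho>. f k z)"
        using that \<open>3 \<le> d\<close> by (intro sum.mono_neutral_right) auto
      then show ?thesis using \<rho> by (simp add: sum.atLeast_Suc_atMost)
    qed
    have sums: "(\<Sum>k=3..\<rho>. Wk k z) = Wk d z + (\<Sum>k=Suc d..\<rho>. Wk k z)"
      "(\<Sum>k=3..\<rho>. Gk k z) = Gk d z + (\<Sum>k=Suc d..\<rho>. Gk k z)" for z
      using low(1) by (auto intro!: split)
    have G1: "G = (\<lambda>z. harm z + (\<Sum>k=Suc d..\<rho>. Gk k z))"
      by (simp add: G sums Gd)
    have W1: "(\<lambda>z. fst (fst z) * fst (snd z) + snd (fst z) * snd (snd z) + (\<Sum>k=3..\<rho>. Wk k z))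
      = (\<lambda>z. fst (fst z) * fst (snd z) + snd (fst z) * snd (snd z)
          + (Dop a z + (\<Sum>k=Suc d..\<rho>. Wk k z)))"
      by (simp add: sums Wd)
    have up: "k \<in> {3..\<rho>}" if "k \<in> {Suc d..\<rho>}" for k using that \<open>3 \<le> d\<close> by simp
    have "poly_on {\<rho>} (grad_diff (Dop a))" unfolding \<rho>_def by (rule poly_on_grad_diff[OF A])
    \<comment> \<open>The second pass starts at degree \<open>Suc d\<close>. The potential has
      cancelled against \<open>Dop (Dop a)\<close>, so only \<open>grad_diff (Dop a)\<close> is left
      as source.\<close>
    note high = generating_function_lowest_degree[OF A \<open>3 \<le> d\<close> _ _ order_refl F this
        Gk(1)[OF up] Gk(2)[OF up] Wk[OF up] W1 G1 res]
    have "(\<Sum>k=Suc d..\<rho>. Gk k z) = (\<Sum>k\<in>{\<rho>}. Gk k z)" for z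
      using \<rho> \<open>3 \<le> d\<close> high(1) by (intro sum.mono_neutral_right) auto
    then have "G = (\<lambda>z. harm z + Gk \<rho> z)" using G1 by simp
    moreover have "kernel_part \<rho> (grad_diff (Dop a)) (Gk \<rho>)"
      unfolding kernel_part_def using Gk[of \<rho>] Wk[of \<rho>] high(2) \<rho> \<open>3 \<le> d\<close> poly_on_Dop
      by (intro conjI exI[of _ "Wk \<rho>"]) auto
    ultimately show "\<exists>g. kernel_part \<rho> (grad_diff (Dop a)) g \<and> G = (\<lambda>z. harm z + g z)"
      by blast
  next
    assume "\<exists>g. kernel_part \<rho> (grad_diff (Dop a)) g \<and> G = (\<lambda>z. harm z + g z)"
    then obtain g where g: "kernel_part \<rho> (grad_diff (Dop a)) g" and G: "G = (\<lambda>z. harm z + g z)"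
      by blast
    show "is_BGNF \<rho> (\<lambda>z. harm z + V (fst z)) G"
      unfolding G by (rule is_BGNF_intro[OF a \<open>3 \<le> d\<close> \<rho>]) (use g F in simp)
  qed
  then show ?thesis by (simp add: \<rho>_def)
qed

section \<open>One degree of freedom along a unit vector\<close>

lemma poly_on_substitute:
  assumes "poly_on {k} f" "poly_on {1} a" "poly_on {1} b" "poly_on {1} c" "poly_on {1} d"
  shows "poly_on {k} (\<lambda>z. f ((a z, b z), (c z, d z)))"
  using assms(1)
proof (induction rule: poly_on_induct)
  case (mon e \<alpha>)
  obtain i j l m where \<alpha>: "\<alpha> = (i,j,l,m)" by (cases \<alpha>)
  have p: "poly_on {n} (\<lambda>z. f z ^ n)" if "poly_on {1} f" for f n
    using poly_on_power[OF that, of n] by simp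
  have mult: "poly_on {i + j} (\<lambda>z. f z * g z)" if "poly_on {i} f" "poly_on {j} g" for i j f g
    using poly_on_mult[OF that] by simp
  have "poly_on {i + j + l + m} (\<lambda>z. a z ^ i * b z ^ j * c z ^ l * d z ^ m)"
    by (intro mult p assms)
  then have "poly_on {k} (\<lambda>z. a z ^ i * b z ^ j * c z ^ l * d z ^ m)"
    using mon by (simp add: \<alpha>)
  from poly_on_cmult[OF this, of e] show ?case by (simp add: \<alpha>)
qed (auto intro: poly_on_add)

text \<open>Since the kernel is trivial in odd degree, the splitting makes \<open>Dop\<close>
  surjective there; this is used twice.\<close>

lemma odd_image_Dop_square:
  assumes "odd k" "poly_on {k} f"
  obtains u where "poly_on {k} u" "f = Dop (Dop u)"
proof -
  have surj: "\<exists>h. poly_on {k} h \<and> f = Dop h" if f: "poly_on {k} f" for f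
  proof -
    obtain g h where g: "poly_on {k} g" "Dop g = (\<lambda>z. 0)" and h: "poly_on {k} h"
      "f = (\<lambda>z. g z + Dop h z)"
      using kernel_image_decomposition[OF f] .
    then show ?thesis
      using odd_kernel_trivial[OF g(1) \<open>odd k\<close> g(2)] by auto
  qed
  obtain h where h: "poly_on {k} h" "f = Dop h" using surj[OF assms(2)] by blast
  obtain u where "poly_on {k} u" "h = Dop u" using surj[OF h(1)] by blast
  with h(2) that show thesis by blast
qed

text \<open>\<open>Dop u\<close> is the degree-\<open>d\<close> term of the generating function for
  the potential \<open>X ^ d\<close>. Its gradients point along (e1, e2) with lengths
  \<open>a\<close> and \<open>b\<close>, and \<open>r\<close> shows that \<open>a^2 - b^2\<close> is
  a multiple of \<open>X ^ (2 * d - 2)\<close> up to an image.\<close>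

lemma oscillator_second_order:
  fixes e1 e2 :: real
  assumes e: "e1\<^sup>2 + e2\<^sup>2 = 1" and d: "odd d" "3 \<le> d"
  defines "X \<equiv> \<lambda>z::pt4. e1 * fst (fst z) + e2 * snd (fst z)"
  obtains u a b r where "poly_on {d} u" "Dop (Dop u) = (\<lambda>z. X z ^ d)"
    "pdx1 (Dop u) = (\<lambda>z. e1 * a z)" "pdx2 (Dop u) = (\<lambda>z. e2 * a z)"
    "pdy1 (Dop u) = (\<lambda>z. e1 * b z)" "pdy2 (Dop u) = (\<lambda>z. e2 * b z)"
    "poly_on {2 * d - 2} r" "\<And>z. (a z)\<^sup>2 - (b z)\<^sup>2 = Dop r z - (2 * real d - 1) * X z ^ (2 * d - 2)"
proof -
  define Y where "Y z = e1 * fst (snd z) + e2 * snd (snd z)" for z :: pt4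
  have X: "poly_on {1} X" and Y: "poly_on {1} Y"
    unfolding X_def Y_def by (intro poly_on_add poly_on_cmult poly_on_coords)+
  have pdX: "pdx1 X = (\<lambda>z. e1)" "pdx2 X = (\<lambda>z. e2)" "pdy1 X = (\<lambda>z. 0)" "pdy2 X = (\<lambda>z. 0)"
    "Dop X = (\<lambda>z. - Y z)"
    unfolding X_def Y_def
    by (simp_all add: pd_add[OF poly_on_cmult[OF poly_on_coords(1)] poly_on_cmult[OF poly_on_coords(2)]]
        pd_cmult[OF poly_on_coords(1)] pd_cmult[OF poly_on_coords(2)] pd_coords Dop_coords)
  have Xd: "poly_on {d} (\<lambda>z. X z ^ d)" using poly_on_power[OF X, of d] by simp
  obtain u where u: "poly_on {d} u" "(\<lambda>z. X z ^ d) = Dop (Dop u)"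
    using odd_image_Dop_square[OF d(1) Xd] .
  define W where "W = Dop u"
  have W: "poly_on {d} W" and DW: "Dop W = (\<lambda>z. X z ^ d)"
    using poly_on_Dop[OF u(1)] u(2) by (simp_all add: W_def)
  \<comment> \<open>\<open>W\<close> and its composition with the projection \<open>\<pi>\<close> onto the direction \<open>(e1, e2)\<close> have the same
    image under \<open>Dop\<close>, so they agree and \<open>W\<close> is a function of \<open>X\<close> and \<open>Y\<close> alone.\<close>
  define \<pi> :: "pt4 \<Rightarrow> pt4" where "\<pi> z = ((e1 * X z, e2 * X z), (e1 * Y z, e2 * Y z))" for z
  have \<pi>: "(\<pi> has_derivative \<pi>) (at z)" for z
    unfolding \<pi>_def X_def Y_def by (auto intro!: derivative_eq_intros)
  have W\<pi>: "poly_on {d} (\<lambda>z. W (\<pi> z))"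
    unfolding \<pi>_def by (intro poly_on_substitute W poly_on_cmult X Y)
  have dd\<pi>: "dd (\<lambda>z. W (\<pi> z)) z h = dd W (\<pi> z) (\<pi> h)" for z h
    by (rule dd_eqI[OF has_derivative_compose[OF \<pi> poly_on_has_derivative[OF W]]])
  have "e1 * (e1 * t) + e2 * (e2 * t) = (e1\<^sup>2 + e2\<^sup>2) * t" for t
    by (simp add: power2_eq_square algebra_simps)
  then have X\<pi>: "X (\<pi> z) = X z" for z
    unfolding X_def \<pi>_def using e by simp
  have \<pi>_rotgen: "\<pi> (rotgen z) = rotgen (\<pi> z)" for z
    by (simp add: \<pi>_def rotgen_def X_def Y_def algebra_simps)
  have "Dop (\<lambda>z. W (\<pi> z)) z = Dop W z" for z
    unfolding Dop_eq_dd[OF W\<pi>] dd\<pi> \<pi>_rotgen Dop_eq_dd[OF W, of "\<pi> z", symmetric] DW X\<pi> ..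
  then have "Dop (\<lambda>z. W (\<pi> z) - W z) = (\<lambda>z. 0)"
    unfolding Dop_diff[OF W\<pi> W] by simp
  from odd_kernel_trivial[OF poly_on_diff[OF W\<pi> W] d(1) this]
  have WW: "(\<lambda>z. W (\<pi> z)) = W" by (simp add: fun_eq_iff)
  define a where "a z = e1 * pdx1 W z + e2 * pdx2 W z" for z
  define b where "b z = e1 * pdy1 W z + e2 * pdy2 W z" for z
  have pW: "dd W z h = dd W (\<pi> z) (\<pi> h)" for z h
    using dd\<pi>[of z h] unfolding WW .
  have L: "dd W z (s *\<^sub>R h) = s * dd W z h" for s z h
    using linear_cmul[OF dd_linear[OF W]] by simp
  \<comment> \<open>Vectors along (e1, e2) are fixed by \<open>\<pi>\<close>, so the derivatives of
    \<open>W\<close> in these directions agree at \<open>z\<close> and at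
    \<open>\<pi> z\<close>.\<close>
  have a': "dd W (\<pi> z) ((e1,e2),(0,0)) = a z" and b': "dd W (\<pi> z) ((0,0),(e1,e2)) = b z" for z
  proof -
    have "\<pi> ((e1,e2),(0,0)) = ((e1,e2),(0,0))" "\<pi> ((0,0),(e1,e2)) = ((0,0),(e1,e2))"
      using e by (simp_all add: \<pi>_def X_def Y_def power2_eq_square)
    then show "dd W (\<pi> z) ((e1,e2),(0,0)) = a z" "dd W (\<pi> z) ((0,0),(e1,e2)) = b z"
      using pW[of z "((e1,e2),(0,0))"] pW[of z "((0,0),(e1,e2))"] dd_eq_pd[OF W]
      by (simp_all add: a_def b_def)
  qed
  have pd: "pdx1 W = (\<lambda>z. e1 * a z)" "pdx2 W = (\<lambda>z. e2 * a z)"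
    "pdy1 W = (\<lambda>z. e1 * b z)" "pdy2 W = (\<lambda>z. e2 * b z)"
  proof -
    have \<pi>1: "\<pi> ((1,0),(0,0)) = e1 *\<^sub>R ((e1,e2),(0,0))" "\<pi> ((0,1),(0,0)) = e2 *\<^sub>R ((e1,e2),(0,0))"
      "\<pi> ((0,0),(1,0)) = e1 *\<^sub>R ((0,0),(e1,e2))" "\<pi> ((0,0),(0,1)) = e2 *\<^sub>R ((0,0),(e1,e2))"
      by (simp_all add: \<pi>_def X_def Y_def)
    show "pdx1 W = (\<lambda>z. e1 * a z)" "pdx2 W = (\<lambda>z. e2 * a z)"
      "pdy1 W = (\<lambda>z. e1 * b z)" "pdy2 W = (\<lambda>z. e2 * b z)"
      unfolding fun_eq_iff pd_eq_dd[OF W] pW[of _ "((1,0),(0,0))"] pW[of _ "((0,1),(0,0))"]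
        pW[of _ "((0,0),(1,0))"] pW[of _ "((0,0),(0,1))"] \<pi>1 L a' b' by simp_all
  qed
  have pda: "poly_on {d - 1} (pdx1 W)" "poly_on {d - 1} (pdx2 W)"
    "poly_on {d - 1} (pdy1 W)" "poly_on {d - 1} (pdy2 W)"
    by (intro poly_on_pd[OF W]; auto)+
  have a: "poly_on {d - 1} a" and b: "poly_on {d - 1} b"
    unfolding a_def b_def by (intro poly_on_add poly_on_cmult pda)+
  have pdV: "pdx1 (Dop W) = (\<lambda>z. real d * X z ^ (d - 1) * e1)"
    "pdx2 (Dop W) = (\<lambda>z. real d * X z ^ (d - 1) * e2)"
    "pdy1 (Dop W) = (\<lambda>z. 0)" "pdy2 (Dop W) = (\<lambda>z. 0)"
    unfolding DW pd_power[OF X] pdX by simp_all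
  have ee: "e1 * (e1 * t) + e2 * (e2 * t) = t" for t
    using e by (simp add: power2_eq_square mult.assoc[symmetric] distrib_right[symmetric])
  have "Dop a = (\<lambda>z. e1 * Dop (pdx1 W) z + e2 * Dop (pdx2 W) z)"
    unfolding a_def[abs_def] pd_add(5)[OF poly_on_cmult[OF pda(1)] poly_on_cmult[OF pda(2)]]
      pd_cmult(5)[OF pda(1)] pd_cmult(5)[OF pda(2)] ..
  then have "Dop a z = e1 * (e1 * (real d * X z ^ (d - 1) - b z)) + e2 * (e2 * (real d * X z ^ (d - 1) - b z))" for z
    unfolding Dop_pd_commutator[OF W] unfolding pdV pd by (simp add: algebra_simps)
  then have Da: "Dop a z = real d * X z ^ (d - 1) - b z" for z
    unfolding ee .
  have "Dop b = (\<lambda>z. e1 * Dop (pdy1 W) z + e2 * Dop (pdy2 W) z)"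
    unfolding b_def[abs_def] pd_add(5)[OF poly_on_cmult[OF pda(3)] poly_on_cmult[OF pda(4)]]
      pd_cmult(5)[OF pda(3)] pd_cmult(5)[OF pda(4)] ..
  then have "Dop b z = e1 * (e1 * a z) + e2 * (e2 * a z)" for z
    unfolding Dop_pd_commutator[OF W] unfolding pdV pd by simp
  then have Db: "Dop b z = a z" for z
    unfolding ee .
  have "Dop W z = X z * b z - Y z * a z" for z
    unfolding Dop_eq_pd pd by (simp add: X_def Y_def algebra_simps)
  then have XY: "Y z * a z = X z * b z - X z ^ d" for z
    by (simp add: DW)
  have Xd1: "poly_on {d - 1} (\<lambda>z. X z ^ (d - 1))" using poly_on_power[OF X, of "d - 1"] by simp
  \<comment> \<open>\<open>Dop (a b)\<close> is \<open>a^2 - b^2 + d X^(d-1) b\<close>. After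
    eliminating \<open>Y a\<close>, \<open>Dop (X^(d-1) a)\<close> is
    \<open>(2 d - 1) X^(2 d - 2) - d X^(d-1) b\<close>, so the mixed terms cancel in the
    sum.\<close>
  define r where "r z = a z * b z + X z ^ (d - 1) * a z" for z
  have ab: "poly_on {2 * d - 2} (\<lambda>z. a z * b z)"
    and Xa: "poly_on {2 * d - 2} (\<lambda>z. X z ^ (d - 1) * a z)"
    using d by (intro poly_on_mult[OF a b] poly_on_mult[OF Xd1 a]; simp)+
  have "(a z)\<^sup>2 - (b z)\<^sup>2 = Dop r z - (2 * real d - 1) * X z ^ (2 * d - 2)" for z
  proof -
    have "d = Suc (Suc (d - 2))" using d by simp
    then obtain m where m: "d = Suc (Suc m)" ..
    have "Dop r z = a z * a z + (real d * X z ^ (d - 1) - b z) * b z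
        + (X z ^ (d - 1) * (real d * X z ^ (d - 1) - b z) - real (d - 1) * X z ^ (d - 2) * (Y z * a z))"
      unfolding r_def[abs_def] pd_add(5)[OF ab Xa] pd_mult(5)[OF a b] pd_mult(5)[OF Xd1 a]
        pd_power(5)[OF X] pdX Da Db by (simp add: algebra_simps numeral_2_eq_2)
    moreover define p where "p = X z ^ m"
    moreover have "X z ^ (d - 1) = X z * p" "X z ^ (d - 2) = p" "X z ^ d = X z * (X z * p)"
      "X z ^ (2 * d - 2) = X z * p * (X z * p)"
      unfolding m p_def by (simp_all add: mult_2 power_add)
    moreover have "real (d - 1) = real d - 1" using d by simp
    ultimately have "Dop r z = a z * a z + (real d * (X z * p) - b z) * b z
        + (X z * p * (real d * (X z * p) - b z) - (real d - 1) * p * (X z * b z - X z * (X z * p)))"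
      and X2: "X z ^ (2 * d - 2) = X z * p * (X z * p)"
      by (simp_all only: XY)
    then show ?thesis
      unfolding X2 by (simp add: algebra_simps power2_eq_square)
  qed
  moreover have "poly_on {2 * d - 2} r"
    unfolding r_def[abs_def] by (intro poly_on_add ab Xa)
  ultimately show thesis
    by (intro that[of u a b r]) (use u pd W_def in auto)
qed

section \<open>Separable potentials\<close>

lemma poly_on_Vpot: "poly_on {n} (\<lambda>z. Vpot n v (fst z))"
proof -
  have "Vpot n v (fst z) = (\<Sum>h=0..n. (v h * real (n choose h)) * mon (h, n - h, 0, 0) z)" for z
    by (cases "fst z") (simp add: mon_eq mult.assoc)
  moreover have "poly_on {n} (\<lambda>z. \<Sum>h=0..n. (v h * real (n choose h)) * mon (h, n - h, 0, 0) z)"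
    by (intro poly_on_sum poly_on_mon) auto
  ultimately show ?thesis by (simp only:)
qed

lemma Vpot_scale: "Vpot n v (s *\<^sub>R q) = s ^ n * Vpot n v q"
  using poly_on_scale[OF poly_on_Vpot[of n v], of s "(q, 0)"] by simp

text \<open>With equal kernel parts the difference of the potentials is an image that depends on
  positions only, and in even degree such an image is zero.\<close>

lemma kernel_part_potential_unique:
  assumes "even n" "kernel_part n (\<lambda>z. Vpot n u (fst z)) g" "kernel_part n (\<lambda>z. Vpot n v (fst z)) g"
  shows "Vpot n u = Vpot n v"
proof
  fix q
  obtain h where h: "poly_on {n} h" "(\<lambda>z. Vpot n u (fst z)) = (\<lambda>z. g z + Dop h z)"
    using assms(2) unfolding kernel_part_def by (elim exE conjE)
  obtain h' where h': "poly_on {n} h'" "(\<lambda>z. Vpot n v (fst z)) = (\<lambda>z. g z + Dop h' z)"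
    using assms(3) unfolding kernel_part_def by (elim exE conjE)
  have "Vpot n u q - Vpot n v q = 0"
  proof (rule even_potential_not_image[OF poly_on_diff[OF h(1) h'(1)] assms(1)])
    show "Dop (\<lambda>z. h z - h' z) z = Vpot n u (fst z) - Vpot n v (fst z)" for z
      using fun_cong[OF h(2), of z] fun_cong[OF h'(2), of z]
      by (simp add: Dop_diff[OF h(1) h'(1)])
  qed (simp add: Vpot_scale right_diff_distrib)
  then show "Vpot n u q = Vpot n v q" by simp
qed

text \<open>The binomial theorem: with the binomial factor built into \<open>Vpot\<close>, a power
  of a linear form has monomial coefficients.\<close>

lemma Vpot_linear_powers:
  "Vpot n (\<lambda>h. A * a ^ h * b ^ (n - h) + B * c ^ h * d ^ (n - h)) q
    = A * (a * fst q + b * snd q) ^ n + B * (c * fst q + d * snd q) ^ n"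
proof (cases q)
  case (Pair x y)
  show ?thesis
    unfolding Pair Vpot.simps fst_conv snd_conv binomial_ring power_mult_distrib atLeast0AtMost
      sum_distrib_left sum.distrib[symmetric]
    by (intro sum.cong) (simp_all add: algebra_simps)
qed

text \<open>The generating function is a sum of two one-dimensional ones whose gradients lie along
  orthogonal directions, so \<open>grad_diff\<close> has no cross terms and each direction
  contributes separately.\<close>

lemma grad_diff_separable:
  fixes \<psi> v0 vd :: real
  assumes d: "odd d" "3 \<le> d"
  defines "X1 \<equiv> \<lambda>z::pt4. cos \<psi> * fst (fst z) + (- sin \<psi>) * snd (fst z)"
    and "X2 \<equiv> \<lambda>z::pt4. sin \<psi> * fst (fst z) + cos \<psi> * snd (fst z)"
  obtains u r where "poly_on {d} u" "Dop (Dop u) = (\<lambda>z. v0 * X2 z ^ d + vd * X1 z ^ d)"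
    "poly_on {2 * d - 2} r"
    "grad_diff (Dop u) = (\<lambda>z. (- (2 * real d - 1) / 2 * v0\<^sup>2 * X2 z ^ (2 * d - 2)
      + - (2 * real d - 1) / 2 * vd\<^sup>2 * X1 z ^ (2 * d - 2)) + Dop r z)"
proof -
  have e: "(cos \<psi>)\<^sup>2 + (- sin \<psi>)\<^sup>2 = 1" "(sin \<psi>)\<^sup>2 + (cos \<psi>)\<^sup>2 = 1"
    by simp_all
  obtain u1 a1 b1 r1 where u1: "poly_on {d} u1" "Dop (Dop u1) = (\<lambda>z. X1 z ^ d)"
    "pdx1 (Dop u1) = (\<lambda>z. cos \<psi> * a1 z)" "pdx2 (Dop u1) = (\<lambda>z. - sin \<psi> * a1 z)"
    "pdy1 (Dop u1) = (\<lambda>z. cos \<psi> * b1 z)" "pdy2 (Dop u1) = (\<lambda>z. - sin \<psi> * b1 z)"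
    and r1: "poly_on {2 * d - 2} r1"
      "\<And>z. (a1 z)\<^sup>2 - (b1 z)\<^sup>2 = Dop r1 z - (2 * real d - 1) * X1 z ^ (2 * d - 2)"
    using oscillator_second_order[OF e(1) d] unfolding X1_def by blast
  obtain u2 a2 b2 r2 where u2: "poly_on {d} u2" "Dop (Dop u2) = (\<lambda>z. X2 z ^ d)"
    "pdx1 (Dop u2) = (\<lambda>z. sin \<psi> * a2 z)" "pdx2 (Dop u2) = (\<lambda>z. cos \<psi> * a2 z)"
    "pdy1 (Dop u2) = (\<lambda>z. sin \<psi> * b2 z)" "pdy2 (Dop u2) = (\<lambda>z. cos \<psi> * b2 z)"
    and r2: "poly_on {2 * d - 2} r2"
      "\<And>z. (a2 z)\<^sup>2 - (b2 z)\<^sup>2 = Dop r2 z - (2 * real d - 1) * X2 z ^ (2 * d - 2)"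
    using oscillator_second_order[OF e(2) d] unfolding X2_def by blast
  define u where "u z = v0 * u2 z + vd * u1 z" for z
  define r where "r z = v0\<^sup>2 / 2 * r2 z + vd\<^sup>2 / 2 * r1 z" for z
  have Du: "Dop u = (\<lambda>z. v0 * Dop u2 z + vd * Dop u1 z)"
    unfolding u_def[abs_def] pd_add(5)[OF poly_on_cmult[OF u2(1)] poly_on_cmult[OF u1(1)]]
      pd_cmult(5)[OF u1(1)] pd_cmult(5)[OF u2(1)] ..
  note W1 = poly_on_Dop[OF u1(1)] and W2 = poly_on_Dop[OF u2(1)]
  note pds = pd_add[OF poly_on_cmult[OF W2] poly_on_cmult[OF W1]] pd_cmult[OF W1] pd_cmult[OF W2]
  have DDu: "Dop (Dop u) = (\<lambda>z. v0 * X2 z ^ d + vd * X1 z ^ d)"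
    unfolding Du pds u1(2) u2(2) ..
  have Dr: "Dop r z = v0\<^sup>2 / 2 * Dop r2 z + vd\<^sup>2 / 2 * Dop r1 z" for z
    unfolding r_def[abs_def] pd_add(5)[OF poly_on_cmult[OF r2(1)] poly_on_cmult[OF r1(1)]]
      pd_cmult(5)[OF r1(1)] pd_cmult(5)[OF r2(1)] ..
  \<comment> \<open>The directions (sin \<psi>, cos \<psi>) and (cos \<psi>, - sin \<psi>) are
    orthonormal, which removes the mixed products of \<open>a\<close> and \<open>b\<close>.\<close>
  have pythagoras: "(x * (sin \<psi> * a) + y * (cos \<psi> * b))\<^sup>2 + (x * (cos \<psi> * a) + y * (- sin \<psi> * b))\<^sup>2
      = x\<^sup>2 * a\<^sup>2 + y\<^sup>2 * b\<^sup>2" for x y a b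
  proof -
    have "(x * (s * a) + y * (c * b))\<^sup>2 + (x * (c * a) + y * (- s * b))\<^sup>2
      = (s\<^sup>2 + c\<^sup>2) * (x\<^sup>2 * a\<^sup>2 + y\<^sup>2 * b\<^sup>2)" for s c
      by (simp add: power2_eq_square algebra_simps)
    from this[of "sin \<psi>" "cos \<psi>"] show ?thesis by simp
  qed
  have gdu: "grad_diff (Dop u) z = (v0\<^sup>2 * ((a2 z)\<^sup>2 - (b2 z)\<^sup>2) + vd\<^sup>2 * ((a1 z)\<^sup>2 - (b1 z)\<^sup>2)) / 2" for z
    using pythagoras[of v0 "a2 z" vd "a1 z"] pythagoras[of v0 "b2 z" vd "b1 z"]
    unfolding grad_diff_def Du pds u1 u2 by (simp add: algebra_simps)
  have "grad_diff (Dop u) z = (- (2 * real d - 1) / 2 * v0\<^sup>2 * X2 z ^ (2 * d - 2)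
      + - (2 * real d - 1) / 2 * vd\<^sup>2 * X1 z ^ (2 * d - 2)) + Dop r z" for z
    unfolding gdu Dr r1(2) r2(2) by (simp add: field_simps)
  then have "grad_diff (Dop u) = (\<lambda>z. (- (2 * real d - 1) / 2 * v0\<^sup>2 * X2 z ^ (2 * d - 2)
      + - (2 * real d - 1) / 2 * vd\<^sup>2 * X1 z ^ (2 * d - 2)) + Dop r z)"
    by (rule ext)
  moreover have "poly_on {d} u" "poly_on {2 * d - 2} r"
    unfolding u_def[abs_def] r_def[abs_def] by (intro poly_on_add poly_on_cmult u1 u2 r1 r2)+
  ultimately show thesis
    using DDu that by blast
qed

section \<open>Rotations and comparison of the two normal forms\<close>

lemma rot_minus_rot: "rot (- \<psi>) (rot \<psi> q) = q"
proof -
  have "c * (c * x - s * y) + s * (s * x + c * y) = (s\<^sup>2 + c\<^sup>2) * x"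
    "c * (s * x + c * y) - s * (c * x - s * y) = (s\<^sup>2 + c\<^sup>2) * y" for x y c s :: real
    by (simp_all add: power2_eq_square algebra_simps)
  from this[where c = "cos \<psi>" and s = "sin \<psi>"] show ?thesis
    by (cases q) simp
qed

lemma rot_rot_minus: "rot \<psi> (rot (- \<psi>) q) = q"
  using rot_minus_rot[of "- \<psi>"] by simp

lemma harm_rot: "harm (rot \<psi> q, rot \<psi> p) = harm (q, p)"
proof -
  have "(c * a - s * b)\<^sup>2 + (s * a + c * b)\<^sup>2 = (s\<^sup>2 + c\<^sup>2) * (a\<^sup>2 + b\<^sup>2)" for a b c s :: real
    by (simp add: power2_eq_square algebra_simps)
  from this[where c = "cos \<psi>" and s = "sin \<psi>"]
  have *: "(cos \<psi> * a - sin \<psi> * b)\<^sup>2 + (sin \<psi> * a + cos \<psi> * b)\<^sup>2 = a\<^sup>2 + b\<^sup>2" for a b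
    by simp
  show ?thesis
    using *[of "fst q" "snd q"] *[of "fst p" "snd p"] by (cases q; cases p) simp
qed

theorem mainTheorem6:
  fixes \<delta> :: nat and v :: "nat \<Rightarrow> real" and \<psi> v0 vd :: real
  assumes "odd \<delta>" and "\<delta> \<ge> 3"
    and "Vpot \<delta> v \<noteq> (\<lambda>_. 0)"
    and "0 \<le> \<psi>" and "\<psi> < 2 * pi" and "(v0, vd) \<noteq> (0, 0)"
    and "\<forall>qt. Vpot \<delta> v (rot (-\<psi>) qt) = v0 * (snd qt)^\<delta> + vd * (fst qt)^\<delta>"
  shows "(\<exists>!H. is_PHO (2*\<delta>-2) H \<and>
             (\<forall>G. is_BGNF (2*\<delta>-2) H G \<longleftrightarrow> is_BGNF (2*\<delta>-2) (Kham \<delta> v) G))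
       \<and> (\<forall>H. is_PHO (2*\<delta>-2) H \<and>
             (\<forall>G. is_BGNF (2*\<delta>-2) H G \<longleftrightarrow> is_BGNF (2*\<delta>-2) (Kham \<delta> v) G)
           \<longrightarrow> (\<exists>w0 w. \<forall>qt pt. H (rot (-\<psi>) qt, rot (-\<psi>) pt)
                 = harm (qt, pt) + w0 * (snd qt)^(2*\<delta>-2) + w * (fst qt)^(2*\<delta>-2)))"
proof -
  define n where "n = 2 * \<delta> - 2"
  have n: "even n" "4 \<le> n" "0 < n" using assms(2) by (auto simp: n_def)
  \<comment> \<open>The factor \<open>- (2 * real \<delta> - 1)\<close> comes from the single
    oscillator, 1/2 from \<open>grad_diff\<close>, and the squares from its being quadratic.\<close>
  define w0 w where "w0 = - (2 * real \<delta> - 1) / 2 * v0\<^sup>2" and "w = - (2 * real \<delta> - 1) / 2 * vd\<^sup>2"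
  \<comment> \<open>The coefficients are those of the powers of the two components of
    \<open>rot \<psi> q\<close>, so \<open>V\<close> is separable by construction.\<close>
  define V where "V = Vpot n (\<lambda>h. w0 * sin \<psi> ^ h * cos \<psi> ^ (n - h) + w * cos \<psi> ^ h * (- sin \<psi>) ^ (n - h))"
  define K where "K = Kham n (\<lambda>h. w0 * sin \<psi> ^ h * cos \<psi> ^ (n - h) + w * cos \<psi> ^ h * (- sin \<psi>) ^ (n - h))"
  have Kham: "Kham m u = (\<lambda>z. harm z + Vpot m u (fst z))" for m u
    by (simp add: Kham_def)
  have V: "V q = w0 * snd (rot \<psi> q) ^ n + w * fst (rot \<psi> q) ^ n" for q
    unfolding V_def Vpot_linear_powers by (cases q) simp
  have rot0: "V (rot (- \<psi>) q) = w0 * snd q ^ n + w * fst q ^ n" for q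
    unfolding V rot_rot_minus ..
  \<comment> \<open>Evaluation on the rotated axes isolates \<open>w0\<close> and \<open>w\<close>;
    they vanish only together with \<open>v0\<close> and \<open>vd\<close>, because
    \<open>2 * real \<delta> - 1\<close> is nonzero.\<close>
  have "V \<noteq> (\<lambda>_. 0)"
  proof
    assume "V = (\<lambda>_. 0)"
    then have "w0 = 0" "w = 0"
      using rot0[of "(0,1)"] rot0[of "(1,0)"] n(3) by (simp_all add: power_0_left)
    then show False
      using assms(2,6) by (auto simp: w0_def w_def)
  qed
  then have PHO: "is_PHO n K"
    unfolding is_PHO_def K_def V_def by blast

  obtain u r where u: "poly_on {\<delta>} u" "Dop (Dop u) =
      (\<lambda>z. v0 * (sin \<psi> * fst (fst z) + cos \<psi> * snd (fst z)) ^ \<delta>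
         + vd * (cos \<psi> * fst (fst z) + (- sin \<psi>) * snd (fst z)) ^ \<delta>)"
    and r: "poly_on {n} r" and gd: "grad_diff (Dop u) =
      (\<lambda>z. (w0 * (sin \<psi> * fst (fst z) + cos \<psi> * snd (fst z)) ^ n
         + w * (cos \<psi> * fst (fst z) + (- sin \<psi>) * snd (fst z)) ^ n) + Dop r z)"
    unfolding n_def w0_def w_def
    by (rule grad_diff_separable[OF assms(1,2), where \<psi> = \<psi> and ?v0.0 = v0 and vd = vd])
  have V\<delta>: "(\<lambda>z. Vpot \<delta> v (fst z)) = Dop (Dop u)"
  proof
    fix z :: pt4
    have "Vpot \<delta> v (fst z) = Vpot \<delta> v (rot (- \<psi>) (rot \<psi> (fst z)))"
      unfolding rot_minus_rot ..
    also have "\<dots> = v0 * snd (rot \<psi> (fst z)) ^ \<delta> + vd * fst (rot \<psi> (fst z)) ^ \<delta>"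
      using assms(7) by blast
    also have "\<dots> = Dop (Dop u) z"
      unfolding u(2) by (cases "fst z") simp
    finally show "Vpot \<delta> v (fst z) = Dop (Dop u) z" .
  qed
  have gd': "grad_diff (Dop u) = (\<lambda>z. V (fst z) + Dop r z)"
    unfolding gd V_def Vpot_linear_powers ..
  have top: "is_BGNF n (Kham n t) G \<longleftrightarrow>
      (\<exists>g. kernel_part n (\<lambda>z. Vpot n t (fst z)) g \<and> G = (\<lambda>z. harm z + g z))" for t G
    unfolding Kham by (rule is_BGNF_top_degree[OF n(2) poly_on_Vpot])
  \<comment> \<open>Both sets of normal forms are given by kernel parts, of \<open>V\<close> and of
    \<open>V\<close> plus the image \<open>Dop r\<close>; these kernel parts coincide.\<close>
  have same: "is_BGNF n K G \<longleftrightarrow> is_BGNF n (Kham \<delta> v) G" for G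
    using is_BGNF_second_order[where V = "Vpot \<delta> v", OF assms(1,2) u(1) V\<delta>, of G]
    unfolding K_def top unfolding V_def[symmetric] Kham n_def[symmetric] gd' kernel_part_add_image[OF r]
    by simp

  have unique: "H = K"
    if H: "is_PHO n H" "\<forall>G. is_BGNF n H G \<longleftrightarrow> is_BGNF n (Kham \<delta> v) G" for H
  proof -
    obtain t where t: "H = Kham n t" using H(1) unfolding is_PHO_def by blast
    obtain g where g: "kernel_part n (\<lambda>z. V (fst z)) g"
      using kernel_part_exists[OF poly_on_Vpot] unfolding V_def by blast
    \<comment> \<open>A single shared normal form suffices: it forces the potential of
      \<open>H\<close> to have the kernel part \<open>g\<close> of \<open>V\<close>, which
      determines an even potential.\<close>
    have "is_BGNF n K (\<lambda>z. harm z + g z)"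
      unfolding K_def top using g unfolding V_def by blast
    then have "is_BGNF n (Kham n t) (\<lambda>z. harm z + g z)"
      using same H(2) t by simp
    then obtain g' where g': "kernel_part n (\<lambda>z. Vpot n t (fst z)) g'"
      "(\<lambda>z. harm z + g z) = (\<lambda>z. harm z + g' z)"
      unfolding top by blast
    have "g' = g"
      using fun_cong[OF g'(2)] by (intro ext) simp
    with g'(1) have "kernel_part n (\<lambda>z. Vpot n t (fst z)) g" by simp
    from kernel_part_potential_unique[OF n(1) this g[unfolded V_def]]
    show "H = K" unfolding t K_def Kham by simp
  qed
  have sep: "K (rot (- \<psi>) qt, rot (- \<psi>) pt) = harm (qt, pt) + w0 * snd qt ^ n + w * fst qt ^ n" for qt pt
    using rot0[of qt] unfolding K_def Kham V_def by (simp add: harm_rot)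
  show ?thesis
    unfolding n_def[symmetric]
  proof (intro conjI)
    show "\<exists>!H. is_PHO n H \<and> (\<forall>G. is_BGNF n H G \<longleftrightarrow> is_BGNF n (Kham \<delta> v) G)"
    proof (rule ex1I[of _ K])
      show "is_PHO n K \<and> (\<forall>G. is_BGNF n K G \<longleftrightarrow> is_BGNF n (Kham \<delta> v) G)"
        by (intro conjI allI PHO same)
    qed (elim conjE, rule unique)
    show "\<forall>H. is_PHO n H \<and> (\<forall>G. is_BGNF n H G \<longleftrightarrow> is_BGNF n (Kham \<delta> v) G)
        \<longrightarrow> (\<exists>w0 w. \<forall>qt pt. H (rot (-\<psi>) qt, rot (-\<psi>) pt)
                 = harm (qt, pt) + w0 * (snd qt)^n + w * (fst qt)^n)"
    proof (intro allI impI, elim conjE)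
      fix H assume "is_PHO n H" "\<forall>G. is_BGNF n H G \<longleftrightarrow> is_BGNF n (Kham \<delta> v) G"
      then have "H = K" by (rule unique)
      show "\<exists>w0 w. \<forall>qt pt. H (rot (-\<psi>) qt, rot (-\<psi>) pt)
          = harm (qt, pt) + w0 * (snd qt)^n + w * (fst qt)^n"
        unfolding \<open>H = K\<close> by (rule exI[of _ w0], rule exI[of _ w], intro allI, rule sep)
    qed
  qed
qed

end
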